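(* Let $p \ge 1$ be real. For an integer $N \ge 2$ define \[ M_p(N) = \int_0^1 \max_{0 \le t \le 1} \Bigg| \sum_{n=1}^N e(nx + n^2 t)\Bigg|^p \, dx , \] where $e(u) = e^{2\pi i u}$. Then there are constants $c_1(p), c_2(p) > 0$, depending only on $p$, such that for all $N \ge 2$, \[ c_1(p)\, N^{a(p)} (\log N)^{b(p)} \le M_p(N) \le c_2(p)\, N^{a(p)} (\log N)^{b(p)}, \] where \[ a(p) = \begin{cases} \tfrac{3p}{4} & (1 \le p \le 4),\\ p-1 & (p > 4),\end{cases} \qquad b(p) = \begin{cases} 1 & (p = 4),\\ 0 & (p \ge 1,\ p \ne 4).\end{cases} \]
   Context: $e(u)$ denotes $e^{2\pi i u}$ for real $u$. *)

theory Defs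
  imports "HOL-Analysis.Analysis"
begin

definition e :: "real \<Rightarrow> complex" where
  "e u = exp (2 * complex_of_real pi * \<i> * complex_of_real u)"

definition weyl_sum :: "nat \<Rightarrow> real \<Rightarrow> real \<Rightarrow> complex" where
  "weyl_sum N x t = (\<Sum>n=1..N. e (real n * x + (real n)\<^sup>2 * t))"

(* The maximum over t is written as a supremum, since Max is only meaningful for finite sets;
   weyl_sum_max_attained shows that the supremum is attained. *)
definition maximal_moment :: "real \<Rightarrow> nat \<Rightarrow> real" where
  "maximal_moment p N = integral {0..1} (\<lambda>x. SUP t\<in>{0..1}. cmod (weyl_sum N x t) powr p)"

definition size_exponent :: "real \<Rightarrow> real" where
  "size_exponent p = (if p \<le> 4 then 3 * p / 4 else p - 1)"

definition log_exponent :: "real \<Rightarrow> real" where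
  "log_exponent p = (if p = 4 then 1 else 0)"

lemma weyl_sum_max_attained:
  assumes "p \<ge> 1"
  shows "\<exists>t\<^sub>0\<in>{0..1}. (SUP t\<in>{0..1}. cmod (weyl_sum N x t) powr p) = cmod (weyl_sum N x t\<^sub>0) powr p
    \<and> (\<forall>t\<in>{0..1}. cmod (weyl_sum N x t) powr p \<le> cmod (weyl_sum N x t\<^sub>0) powr p)"
proof -
  let ?f = "\<lambda>t. cmod (weyl_sum N x t) powr p"
  have "continuous_on {0..1} ?f"
    unfolding weyl_sum_def e_def
    by (rule continuous_on_powr') (use assms in \<open>auto intro!: continuous_intros\<close>)
  then obtain t0 where t0: "t0 \<in> {0..1}" "\<And>t. t \<in> {0..1} \<Longrightarrow> ?f t \<le> ?f t0"
    using continuous_attains_sup[of "{0..1::real}" ?f] by auto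
  then have "(SUP t\<in>{0..1}. ?f t) = ?f t0"
    by (intro cSup_eq_maximum) auto
  with t0 show ?thesis by blast
qed

end

theory Submission
  imports Defs "HOL-Number_Theory.Totient"
begin

text \<open>Upper bound: if \<open>\<bar>S(x, t)\<bar> \<ge> L\<close> with \<open>L \<ge> 24 N\<^bsup>3/4\<^esup>\<close>, approximate \<open>2 t\<close> by \<open>a / q\<close>. In
  \<open>\<bar>S\<bar>\<^sup>2\<close> the pairs lying in different residue classes modulo \<open>q\<close> contribute geometric sums of total
  size \<open>O(N\<^bsup>3/2\<^esup>)\<close>, so some class carries a large sum. On a class the phase is quadratic with a tiny
  second difference, and the Kusmin--Landau inequality forces \<open>\<bar>q' x - b\<bar> \<le> C N / L\<^sup>2\<close> for some
  \<open>q' \<le> C N\<^sup>2 / L\<^sup>2\<close>. Hence the maximal function exceeds \<open>L\<close> on a set of measure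
  \<open>O(N\<^sup>3 / L\<^sup>4)\<close>; summing over dyadic \<open>L\<close> gives the bound, with the logarithm at \<open>p = 4\<close>.

  Lower bound: for \<open>x\<close> within \<open>1 / (40 N)\<close> of \<open>b / q\<close>, \<open>q \<le> \<surd>N\<close>, the choice \<open>t = 1 / (4 q)\<close> makes the
  sum a quadratic Gauss sum of size about \<open>N / \<surd>q\<close>, whatever \<open>b\<close> is. These arcs are disjoint for
  distinct reduced fractions.\<close>

section \<open>Exponential sums with monotone phase increments\<close>

text \<open>The obstacle is the supremum: the maximising \<open>t\<close> depends on
  \<open>x\<close> in an uncontrolled way, so a large value has to become a condition on
  \<open>x\<close> alone. The approximation \<open>a / q\<close> of \<open>2 t\<close> is therefore
  only a means; what survives is a fraction near \<open>x\<close>, and the exceptional set is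
  covered by allowing every such fraction. With denominators up to \<open>Q = C N^2 / L^2\<close>
  and arcs \<open>|q x - b| <= R\<close>, \<open>R = C N / L^2\<close>, there are about
  \<open>q\<close> arcs of length \<open>2 R / q\<close> for each \<open>q\<close>, hence total
  length of order \<open>Q R\<close>. The threshold \<open>N^(3/4)\<close> is where the differencing
  error is still a fixed fraction of \<open>L^2\<close>; smaller values contribute at most a
  constant times \<open>N^(3 p / 4)\<close>, which the claim allows for every \<open>p\<close>.
  Above it the scale \<open>L\<close> weighs \<open>N^3 L^(p - 4)\<close>, so the smallest scale
  dominates for \<open>p < 4\<close>, the largest for \<open>p > 4\<close>, and at
  \<open>p = 4\<close> all scales weigh the same. The arcs of the lower bound give
  \<open>N^(p - 1)\<close> times the sum of \<open>totient q * q powr (- p / 2)\<close> over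
  \<open>q <= sqrt N\<close>, which changes behaviour at the same exponent.\<close>

lemma e_eq_cis: "e u = cis (2 * pi * u)"
  by (simp add: e_def cis_conv_exp mult_ac)

lemma e_add: "e (u + v) = e u * e v"
  by (simp add: e_eq_cis cis_mult distrib_left)

lemma norm_e [simp]: "cmod (e u) = 1"
  by (simp add: e_eq_cis)

lemma e_0 [simp]: "e 0 = 1"
  by (simp add: e_eq_cis)

lemma e_minus: "e (- u) = cnj (e u)"
  by (simp add: e_eq_cis cis_cnj)

lemma e_diff: "e (u - v) = e u * cnj (e v)"
  using e_add[of u "- v"] by (simp add: e_minus)

lemma e_of_int [simp]: "e (of_int k) = 1"
  using cis_multiple_2pi[of "of_int k"] by (simp add: e_eq_cis mult_ac)

lemma e_of_nat_mult: "e (real n * u) = e u ^ n"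
  by (induction n) (simp_all add: distrib_right e_add)

lemma e_minus_1_eq: "e u - 1 = 2 * \<i> * sin (pi * u) * cis (pi * u)"
    by (simp add: e_eq_cis complex_eq_iff cos_double sin_double power2_eq_square
        mult.assoc mult.left_commute[of pi 2] cos_squared_eq[unfolded power2_eq_square])

lemma norm_e_minus_1: "cmod (e u - 1) = 2 * \<bar>sin (pi * u)\<bar>"
  by (simp add: e_minus_1_eq norm_mult)

lemma norm_e_minus_1_le: "cmod (e u - 1) \<le> 2 * pi * \<bar>u\<bar>"
  using abs_sin_x_le_abs_x[of "pi * u"] by (simp add: norm_e_minus_1 abs_mult)

section \<open>Jordan's inequality and the cotangent form of the summation weights\<close>

text \<open>Sine is concave on \<open>{0..pi}\<close>, so it lies above its chord from
  \<open>0\<close> to \<open>pi/2\<close>.\<close>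

lemma sin_pi_ge:
  assumes "0 \<le> x" "x \<le> 1/2"
  shows "2 * x \<le> sin (pi * x)"
proof -
  have "convex_on {0..pi} (\<lambda>y. - sin y)"
    by (rule f''_ge0_imp_convex[where f' = "\<lambda>y. - cos y" and f'' = sin])
      (auto intro!: derivative_eq_intros sin_ge_zero)
  from convex_onD[OF this, of "2 * x" 0 "pi/2"] assms
  show ?thesis by (simp add: mult.commute)
qed

lemma sin_pi_ge':
  assumes "0 \<le> d" "d \<le> x" "x \<le> 1 - d"
  shows "2 * d \<le> sin (pi * x)"
proof (cases "x \<le> 1/2")
  case True
  then show ?thesis using sin_pi_ge[of x] assms by linarith
next
  case False
  have "sin (pi * x) = sin (pi * (1 - x))" 
    by (simp add: right_diff_distrib)
  moreover have "2 * (1 - x) \<le> sin (pi * (1 - x))"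
    using False assms by (intro sin_pi_ge) auto
  moreover have "2 * d \<le> 2 * (1 - x)"
    using assms by simp
  ultimately show ?thesis by (metis order_trans)
qed

text \<open>The constant real part is the point: these reciprocals move on a vertical line, so their
  variation is that of a real monotone function.\<close>

lemma inverse_e_minus_1:
  assumes "sin (pi * u) \<noteq> 0"
  shows "1 / (e u - 1) = Complex (- 1/2) (- cot (pi * u) / 2)"
proof -
  have "1 / (e u - 1) = cis (- (pi * u)) / (2 * \<i> * sin (pi * u))"
    unfolding e_minus_1_eq by (simp add: cis_divide[symmetric] divide_simps flip: cis_inverse)
  also have "\<dots> = Complex (- 1/2) (- cot (pi * u) / 2)"
    using assms by (simp add: complex_eq_iff cot_def Re_divide Im_divide field_simps power2_eq_square)
  finally show ?thesis .
qed

lemma cot_antimono: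
  assumes "0 < a" "a \<le> b" "b < pi"
  shows "cot b \<le> cot a"
proof -
  have s: "sin a > 0" "sin b > 0" using assms by (auto intro!: sin_gt_zero)
  have "cot a - cot b = sin (b - a) / (sin a * sin b)"
    using s by (simp add: cot_def sin_diff field_simps)
  moreover have "sin (b - a) \<ge> 0" using assms by (intro sin_ge_zero) auto
  ultimately show ?thesis using s by (smt (verit) divide_nonneg_nonneg mult_nonneg_nonneg)
qed

text \<open>With \<open>c\<^sub>k = 1 / (e (f (k + 1) - f k) - 1)\<close> one has
  \<open>e (f k) = c\<^sub>k * (e (f (k + 1)) - e (f k))\<close>. Summation by parts leaves the total variation of
  \<open>c\<close>, and this telescopes because \<open>c\<^sub>k\<close> is an affine function of a monotone cotangent.\<close>

lemma kusmin_landau_unit: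
  fixes f :: "nat \<Rightarrow> real"
  assumes d: "0 < d" 
    and inc: "\<And>k. k \<le> K \<Longrightarrow> d \<le> f (Suc k) - f k \<and> f (Suc k) - f k \<le> 1 - d"
    and mono: "\<And>k. k < K \<Longrightarrow> f (Suc k) - f k \<le> f (Suc (Suc k)) - f (Suc k)"
  shows "cmod (\<Sum>k\<le>K. e (f k)) \<le> 1 / d"
proof -
  define D where "D = (\<lambda>k. f (Suc k) - f k)"
  define c where "c = (\<lambda>k. 1 / (e (D k) - 1))"
  define z where "z = (\<lambda>k. e (f k))"
  have D: "d \<le> D k" "D k \<le> 1 - d" if "k \<le> K" for k
    using inc[OF that] by (auto simp: D_def)
  have s: "2 * d \<le> sin (pi * D k)" if "k \<le> K" for k
    using D[OF that] d by (intro sin_pi_ge') auto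
  have c_eq: "c k = Complex (- 1/2) (- cot (pi * D k) / 2)" if "k \<le> K" for k
    unfolding c_def using s[OF that] d by (intro inverse_e_minus_1) auto
  have c_le: "cmod (c k) \<le> 1 / (4 * d)" if "k \<le> K" for k
  proof -
    have "cmod (c k) = 1 / (2 * sin (pi * D k))"
      using s[OF that] d by (simp add: c_def norm_divide norm_e_minus_1)
    also have "\<dots> \<le> 1 / (4 * d)"
      using s[OF that] d by (intro divide_left_mono) auto
    finally show ?thesis .
  qed
  have z: "z k = c k * (z (Suc k) - z k)" if "k \<le> K" for k
  proof -
    have "z (Suc k) = z k * e (D k)"
      by (simp add: z_def D_def flip: e_add)
    moreover have "e (D k) - 1 \<noteq> 0"
      using norm_e_minus_1[of "D k"] s[OF that] d by auto
    ultimately show ?thesis by (simp add: c_def field_simps)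
  qed
  have parts: "(\<Sum>k\<le>n. z k) = c n * z (Suc n) - c 0 * z 0 - (\<Sum>k<n. (c (Suc k) - c k) * z (Suc k))"
    if "n \<le> K" for n
    using that
  proof (induction n)
    case 0
    then show ?case using z[of 0] by (simp add: algebra_simps)
  next
    case (Suc n)
    then have IH: "(\<Sum>k\<le>n. z k) = c n * z (Suc n) - c 0 * z 0 - (\<Sum>k<n. (c (Suc k) - c k) * z (Suc k))"
      by simp
    have "z (Suc n) + c (Suc n) * z (Suc n) = c (Suc n) * z (Suc (Suc n))"
      using z[of "Suc n"] Suc.prems by (simp add: algebra_simps)
    then show ?case
      unfolding sum.atMost_Suc sum.lessThan_Suc IH by (simp add: left_diff_distrib eq_diff_eq)
  qed
  have tv: "(\<Sum>k<n. cmod (c (Suc k) - c k)) = (cot (pi * D 0) - cot (pi * D n)) / 2" if "n \<le> K" for n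
    using that
  proof (induction n)
    case (Suc n)
    have "cot (pi * D (Suc n)) \<le> cot (pi * D n)"
      using D[of n] D[of "Suc n"] d Suc.prems mono[of n] mult_strict_left_mono[of "D (Suc n)" 1 pi]
      by (intro cot_antimono) (auto simp: D_def)
    then have "cmod (c (Suc n) - c n) = (cot (pi * D n) - cot (pi * D (Suc n))) / 2"
      using Suc.prems by (simp add: c_eq complex_diff cmod_def diff_divide_distrib[symmetric])
    then show ?case using Suc by (simp add: field_simps)
  qed simp
  have cot_le: "\<bar>cot (pi * D k) / 2\<bar> \<le> 1 / (4 * d)" if "k \<le> K" for k
    using abs_Im_le_cmod[of "c k"] c_le[OF that] that by (simp add: c_eq)
  have "cmod (\<Sum>k\<le>K. z k) \<le> cmod (c K * z (Suc K)) + cmod (c 0 * z 0) 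
      + cmod (\<Sum>k<K. (c (Suc k) - c k) * z (Suc k))"
    unfolding parts[OF order.refl]
    by (meson norm_triangle_ineq4 order_trans add_right_mono)
  also have "\<dots> \<le> cmod (c K) + cmod (c 0) + (\<Sum>k<K. cmod (c (Suc k) - c k))"
    by (intro add_mono sum_norm_le) (auto simp: norm_mult z_def)
  \<comment> \<open>Two boundary terms, and two endpoint values \<open>cot / 2\<close> left by the
    telescoped variation. The latter are imaginary parts of \<open>c 0\<close> and
    \<open>c K\<close>, so they obey the same bound.\<close>
  also have "\<dots> \<le> 1 / (4 * d) + 1 / (4 * d) + (1 / (4 * d) + 1 / (4 * d))"
    using c_le[of K] c_le[of 0] tv[of K] cot_le[of 0] cot_le[of K] by (simp add: abs_le_iff diff_divide_distrib)
  finally show ?thesis using d by (simp add: z_def field_simps)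
qed

text \<open>Subtracting \<open>real k * m\<close> moves the increments into the unit interval
  without changing any \<open>e (f k)\<close>. The unit version also controls the increment leaving
  the last summand, about which nothing is assumed here; so the last term is split off and estimated
  by \<open>1 <= 1 / d\<close>, whence the doubled constant.\<close>

lemma kusmin_landau_mono:
  fixes f :: "nat \<Rightarrow> real" and m :: int and d :: real
  assumes d: "0 < d" "d \<le> 1/2"
    and inc: "\<And>k. Suc k < K \<Longrightarrow> real_of_int m + d \<le> f (Suc k) - f k \<and> f (Suc k) - f k \<le> real_of_int m + 1 - d"
    and mono: "\<And>k. Suc (Suc k) < K \<Longrightarrow> f (Suc k) - f k \<le> f (Suc (Suc k)) - f (Suc k)"
  shows "cmod (\<Sum>k<K. e (f k)) \<le> 2 / d"
proof -
  define g where "g = (\<lambda>k. f k - real k * m)"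
  have eg: "e (f k) = e (g k)" for k
    using e_add[of "g k" "of_int (int k * m)"] e_of_int[of "int k * m"] by (simp add: g_def)
  have d1: "1 \<le> 1 / d" using d by (simp add: field_simps)
  consider "K = 0" | "K = 1" | L where "K = Suc (Suc L)"
    by (metis One_nat_def not0_implies_Suc)
  then show ?thesis
  proof cases
    case 3
    have "cmod (\<Sum>k\<le>L. e (g k)) \<le> 1 / d"
    proof (rule kusmin_landau_unit[OF d(1)])
      show "d \<le> g (Suc k) - g k \<and> g (Suc k) - g k \<le> 1 - d" if "k \<le> L" for k
        using inc[of k] that 3 by (auto simp: g_def algebra_simps)
      show "g (Suc k) - g k \<le> g (Suc (Suc k)) - g (Suc k)" if "k < L" for k
        using mono[of k] that 3 by (auto simp: g_def algebra_simps)
    qed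
    moreover have "(\<Sum>k<K. e (f k)) = (\<Sum>k\<le>L. e (g k)) + e (g (Suc L))"
      by (simp add: 3 lessThan_Suc_atMost eg)
    ultimately show ?thesis
      using norm_triangle_ineq[of "\<Sum>k\<le>L. e (g k)" "e (g (Suc L))"] d1 by simp
  qed (use d d1 in auto)
qed

text \<open>Linear increments are monotone. Decreasing ones are reversed by complex conjugation,
  which carries the window between \<open>m\<close> and \<open>m + 1\<close> to the one between
  \<open>- m - 1\<close> and \<open>- m\<close>.\<close>

lemma kusmin_landau:
  fixes f :: "nat \<Rightarrow> real" and m :: int and d :: real
  assumes f: "\<And>k. f (Suc k) - f k = \<alpha> + real k * \<eta>"
    and d: "0 < d" "d \<le> 1/2"
    and inc: "\<And>k. Suc k < K \<Longrightarrow> real_of_int m + d \<le> \<alpha> + real k * \<eta> \<and> \<alpha> + real k * \<eta> \<le> real_of_int m + 1 - d"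
  shows "cmod (\<Sum>k<K. e (f k)) \<le> 2 / d"
proof (cases "\<eta> \<ge> 0")
  case True
  then show ?thesis
    using inc by (intro kusmin_landau_mono[OF d, where m = m]) (auto simp: f algebra_simps)
next
  case False
  have "cmod (\<Sum>k<K. e (- f k)) \<le> 2 / d"
  proof (rule kusmin_landau_mono[OF d, where m = "- m - 1" and f = "\<lambda>k. - f k"], goal_cases)
    case (1 k)
    then show ?case using f[of k] inc[of k] by simp
  next
    case (2 k)
    show ?case using f[of k] f[of "Suc k"] False by (simp add: algebra_simps)
  qed
  also have "(\<Sum>k<K. e (- f k)) = cnj (\<Sum>k<K. e (f k))"
    by (simp add: e_minus)
  finally show ?thesis by (simp only: complex_mod_cnj)
qed

text \<open>The terms whose increment lies within \<open>\<surd>\<eta>\<close> of an integer are counted trivially.\<close>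

lemma quadratic_sum_pos:
  fixes f :: "nat \<Rightarrow> real" and m :: int
  assumes f: "\<And>k. f (Suc k) - f k = \<alpha> + real k * \<eta>"
    and \<eta>: "0 < \<eta>" "\<eta> \<le> 1"
    and inc: "\<And>k. Suc k < K \<Longrightarrow> \<bar>\<alpha> + real k * \<eta> - m\<bar> \<le> 5/8"
  shows "cmod (\<Sum>k<K. e (f k)) \<le> 15 / sqrt \<eta>"
proof -
  \<comment> \<open>An increment within \<open>5/8\<close> of \<open>m\<close> is at least
    \<open>3/8\<close> away from \<open>m - 1\<close> and \<open>m + 1\<close>. As
    \<open>d <= 3/8\<close>, leaving the \<open>d\<close>-neighbourhood of \<open>m\<close> means
    being \<open>d\<close>-far from every integer.\<close>
  define d where "d = 3/8 * sqrt \<eta>"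
  have s1: "0 < sqrt \<eta>" "sqrt \<eta> \<le> 1" using \<eta> by auto
  have d: "0 < d" "d \<le> 3/8" using s1 by (auto simp: d_def)
  have ss: "sqrt \<eta> * sqrt \<eta> = \<eta>" using \<eta> by simp
  \<comment> \<open>The range splits at \<open>a\<close> and \<open>b\<close> into increments below,
    near and above \<open>m\<close>. The disjunct \<open>k \<ge> K\<close> makes the minimum exist
    and caps it at \<open>K\<close>.\<close>
  define a where "a = (LEAST k. k \<ge> K \<or> m - d \<le> \<alpha> + real k * \<eta>)"
  define b where "b = (LEAST k. k \<ge> K \<or> m + d < \<alpha> + real k * \<eta>)"
  have a: "a \<ge> K \<or> m - d \<le> \<alpha> + real a * \<eta>"
    unfolding a_def by (rule LeastI[of _ K]) simp
  have b: "b \<ge> K \<or> m + d < \<alpha> + real b * \<eta>"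
    unfolding b_def by (rule LeastI[of _ K]) simp
  have aK: "a \<le> K" and bK: "b \<le> K"
    unfolding a_def b_def by (auto intro: Least_le)
  have ab: "a \<le> b"
    using b d unfolding a_def by (intro Least_le) auto
  have lt_a: "\<alpha> + real k * \<eta> < m - d" if "k < a" for k
    using not_less_Least[OF that[unfolded a_def]] by auto
  have lt_b: "\<alpha> + real k * \<eta> \<le> m + d" if "k < b" for k
    using not_less_Least[OF that[unfolded b_def]] by auto
  have shift: "f (c + Suc k) - f (c + k) = (\<alpha> + real c * \<eta>) + real k * \<eta>" for c k
    using f[of "c + k"] by (simp add: algebra_simps)
  have A: "cmod (\<Sum>k<a. e (f k)) \<le> 2 / d"
  proof (rule kusmin_landau[OF f, where m = "m - 1"])
    fix k assume k: "Suc k < a"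
    then show "real_of_int (m - 1) + d \<le> \<alpha> + real k * \<eta> \<and> \<alpha> + real k * \<eta> \<le> real_of_int (m - 1) + 1 - d"
      using lt_a[of k] inc[of k] d aK by (auto simp: abs_le_iff)
  qed (use d in auto)
  have B: "cmod (\<Sum>k<K-b. e (f (b + k))) \<le> 2 / d"
  proof (rule kusmin_landau[OF shift, where m = m])
    fix k assume k: "Suc k < K - b"
    have "real k * \<eta> \<ge> 0" using \<eta> by simp
    moreover have "\<bar>\<alpha> + real (b + k) * \<eta> - m\<bar> \<le> 5/8" using k by (intro inc) auto
    ultimately show "real_of_int m + d \<le> \<alpha> + real b * \<eta> + real k * \<eta> \<and> \<alpha> + real b * \<eta> + real k * \<eta> \<le> real_of_int m + 1 - d"
      using b d k by (auto simp: abs_le_iff algebra_simps)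
  qed (use d in auto)
  \<comment> \<open>The increments grow by \<open>\<eta>\<close> at each step and stay in a window
    of length \<open>2 * d\<close>.\<close>
  have C: "real (b - a) \<le> 2 * d / \<eta> + 1"
  proof (cases "a < b")
    case True
    have "m - d \<le> \<alpha> + real a * \<eta>" using a True bK by auto
    moreover have "\<alpha> + real (b - 1) * \<eta> \<le> m + d" using True by (intro lt_b) auto
    ultimately have "(real (b - 1) - real a) * \<eta> \<le> 2 * d" by (simp add: algebra_simps)
    then have "real (b - 1) - real a \<le> 2 * d / \<eta>" using \<eta> by (simp add: field_simps)
    then show ?thesis using True by (simp add: of_nat_diff)
  qed (use d \<eta> in auto)
  have split1: "(\<Sum>k<K. e (f k)) = (\<Sum>k<b. e (f k)) + (\<Sum>k<K-b. e (f (b + k)))"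
    using sum.atLeastLessThan_concat[of 0 b K "\<lambda>k. e (f k)"] bK sum.shift_bounds_nat_ivl[of "\<lambda>k. e (f k)" 0 b "K - b"]
    by (simp add: atLeast0LessThan add.commute)
  have split2: "(\<Sum>k<b. e (f k)) = (\<Sum>k<a. e (f k)) + (\<Sum>k\<in>{a..<b}. e (f k))"
    using ab by (simp add: sum.atLeastLessThan_concat flip: atLeast0LessThan)
  have "cmod (\<Sum>k\<in>{a..<b}. e (f k)) \<le> real (b - a)"
    using sum_norm_le[of "{a..<b}" "\<lambda>k. e (f k)" "\<lambda>_. 1"] by simp
  then have "cmod (\<Sum>k<K. e (f k)) \<le> 2 / d + (2 * d / \<eta> + 1) + 2 / d"
    unfolding split1 split2 using A B C by (intro order_trans[OF norm_triangle_ineq] add_mono) auto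
  also have "2 * d / \<eta> = 3/4 / sqrt \<eta>"
    using s1 ss by (simp add: d_def field_simps)
  also have "1 \<le> 1 / sqrt \<eta>" using s1 by simp
  also have "2 / d + (3/4 / sqrt \<eta> + 1 / sqrt \<eta>) + 2 / d \<le> 15 / sqrt \<eta>"
    using s1 by (simp add: d_def field_simps)
  finally show ?thesis by simp
qed

lemma quadratic_sum:
  fixes f :: "nat \<Rightarrow> real" and m :: int
  assumes f: "\<And>k. f (Suc k) - f k = \<alpha> + real k * \<eta>"
    and \<eta>: "\<eta> \<noteq> 0" "\<bar>\<eta>\<bar> \<le> 1"
    and inc: "\<And>k. Suc k < K \<Longrightarrow> \<bar>\<alpha> + real k * \<eta> - m\<bar> \<le> 5/8"
  shows "cmod (\<Sum>k<K. e (f k)) \<le> 15 / sqrt \<bar>\<eta>\<bar>"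
proof (cases "\<eta> > 0")
  case True
  then show ?thesis using quadratic_sum_pos[OF f, of K m] \<eta> inc by simp
next
  case False
  have "cmod (\<Sum>k<K. e (- f k)) \<le> 15 / sqrt (- \<eta>)"
  proof (rule quadratic_sum_pos[where m = "- m" and \<alpha> = "- \<alpha>"])
    show "- f (Suc k) - - f k = - \<alpha> + real k * - \<eta>" for k
      using f[of k] by simp
    show "\<bar>- \<alpha> + real k * - \<eta> - real_of_int (- m)\<bar> \<le> 5/8" if "Suc k < K" for k
      using inc[OF that, unfolded abs_le_iff] unfolding abs_le_iff by simp
  qed (use False \<eta> in auto)
  also have "(\<Sum>k<K. e (- f k)) = cnj (\<Sum>k<K. e (f k))"
    by (simp add: e_minus)
  finally show ?thesis using False by (simp only: complex_mod_cnj abs_of_nonpos not_less)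
qed

text \<open>The increments stay within \<open>V\<close> of \<open>y\<close>, whose distance to the
  integers is \<open>W\<close>. If \<open>V\<close> is at most \<open>W / 4\<close>, they keep
  distance \<open>3/4 * W\<close> from all integers and Kusmin-Landau applies. Otherwise they lie
  within \<open>W + V <= 1/2 + 1/8 = 5/8\<close> of the nearest integer, and only the size of the
  second difference \<open>\<eta>\<close> helps.\<close>

lemma quadratic_sum_dichotomy:
  fixes f :: "nat \<Rightarrow> real"
  assumes f: "\<And>k. f (Suc k) - f k = \<alpha> + real k * \<eta>"
    and \<eta>: "\<bar>\<eta>\<bar> \<le> 1"
    and inc: "\<And>k. Suc k < K \<Longrightarrow> \<bar>\<alpha> + real k * \<eta> - y\<bar> \<le> V"
    and V: "V \<le> 1/8" "\<eta> = 0 \<Longrightarrow> V = 0"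
    and W: "W = \<bar>y - of_int (round y)\<bar>" "0 < W"
  shows "4 * V \<le> W \<and> cmod (\<Sum>k<K. e (f k)) \<le> 3 / W \<or>
    W < 4 * V \<and> \<eta> \<noteq> 0 \<and> cmod (\<Sum>k<K. e (f k)) \<le> 15 / sqrt \<bar>\<eta>\<bar>"
proof -
  have W2: "W \<le> 1/2" using of_int_round_abs_le[of y] W by (simp add: abs_minus_commute)
  define b where "b = round y"
  show ?thesis
  proof (cases "4 * V \<le> W")
    case True
    \<comment> \<open>\<open>y\<close> lies between \<open>m\<close> and \<open>m + 1\<close>. The
      far end of this window is also safe: its distance from \<open>y\<close> is
      \<open>1 - W\<close>, and \<open>1 - W - W / 4 >= 3/4 * W\<close> since
      \<open>W <= 1/2\<close>.\<close>
    define m where "m = (if y \<ge> of_int b then b else b - 1)"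
    have "cmod (\<Sum>k<K. e (f k)) \<le> 2 / (3/4 * W)"
    proof (rule kusmin_landau[OF f, where m = m])
      show "real_of_int m + 3/4 * W \<le> \<alpha> + real k * \<eta> \<and> \<alpha> + real k * \<eta> \<le> real_of_int m + 1 - 3/4 * W"
        if "Suc k < K" for k
      proof (cases "y \<ge> of_int b")
        case True
        then have "m = b" "W = y - of_int b" using W by (auto simp: m_def b_def)
        then show ?thesis using inc[OF that] \<open>4 * V \<le> W\<close> W2 by linarith
      next
        case False
        then have "m = b - 1" "W = of_int b - y" using W by (auto simp: m_def b_def)
        then show ?thesis using inc[OF that] \<open>4 * V \<le> W\<close> W2 by linarith
      qed
    qed (use W W2 in auto)
    also have "\<dots> \<le> 3 / W" using W by (simp add: field_simps)
    finally show ?thesis using True by blast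
  next
    case False
    have "\<eta> \<noteq> 0" using V False W by auto
    moreover have "cmod (\<Sum>k<K. e (f k)) \<le> 15 / sqrt \<bar>\<eta>\<bar>"
    proof (rule quadratic_sum[OF f, where m = b])
      show "\<bar>\<alpha> + real k * \<eta> - real_of_int b\<bar> \<le> 5/8" if "Suc k < K" for k
        using inc[OF that] V(1) W W2 by (auto simp: b_def abs_if split: if_splits)
    qed (use \<open>\<eta> \<noteq> 0\<close> \<eta> in auto)
    ultimately show ?thesis using False by simp
  qed
qed

section \<open>Differencing off the main residue classes\<close>

text \<open>In the expanded square, pairs congruent modulo \<open>q\<close> reassemble into squares
  of class sums; these are the pairs whose correlations may fail to cancel. The other pairs are
  grouped by their difference \<open>h\<close>. The half \<open>L\<close> is the mirror image of
  \<open>U\<close> and contributes its conjugate, hence the factor 2.\<close>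

lemma norm_sum_square_le_classes:
  fixes z :: "nat \<Rightarrow> complex"
  assumes q: "q > 0"
  shows "(cmod (\<Sum>n<N. z n))\<^sup>2 \<le> (\<Sum>r<q. (cmod (\<Sum>n | n < N \<and> n mod q = r. z n))\<^sup>2)
    + 2 * (\<Sum>h | 0 < h \<and> h < N \<and> \<not> q dvd h. cmod (\<Sum>m<N-h. z (m + h) * cnj (z m)))"
proof -
  define w where "w = (\<lambda>(n, m). z n * cnj (z m))"
  define D where "D = {(n, m). n < N \<and> m < N \<and> n mod q = m mod q}"
  define U where "U = {(n, m). n < N \<and> m < n \<and> n mod q \<noteq> m mod q}"
  define L where "L = prod.swap ` U"
  define A where "A = (\<lambda>r. {n. n < N \<and> n mod q = r})"
  define H where "H = {h. 0 < h \<and> h < N \<and> \<not> q dvd h}"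
  have fin: "finite D" "finite U" "finite L"
  proof -
    have "D \<subseteq> {..<N} \<times> {..<N}" "U \<subseteq> {..<N} \<times> {..<N}" by (auto simp: D_def U_def)
    then show "finite D" "finite U" "finite L"
      unfolding L_def by (meson finite_SigmaI finite_imageI finite_lessThan finite_subset)+
  qed
  have "complex_of_real ((cmod (\<Sum>n<N. z n))\<^sup>2) = (\<Sum>n<N. z n) * cnj (\<Sum>n<N. z n)"
    by (rule complex_norm_square)
  also have "\<dots> = sum w ({..<N} \<times> {..<N})"
    by (simp add: sum_product w_def sum.cartesian_product)
  also have "{..<N} \<times> {..<N} = D \<union> (U \<union> L)"
  proof (intro equalityI subsetI)
    fix p assume "p \<in> {..<N} \<times> {..<N}"
    then obtain n m where p: "p = (n, m)" "n < N" "m < N" by auto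
    show "p \<in> D \<union> (U \<union> L)"
    proof (cases "n mod q = m mod q")
      case False
      then have "n < m \<or> m < n" by (metis linorder_neqE_nat)
      then show ?thesis using p False
        by (auto simp: U_def L_def image_iff)
    qed (use p in \<open>auto simp: D_def\<close>)
  qed (auto simp: D_def U_def L_def)
  also have "sum w (D \<union> (U \<union> L)) = sum w D + (sum w U + sum w L)"
  proof -
    have "D \<inter> (U \<union> L) = {}" "U \<inter> L = {}" by (auto simp: D_def U_def L_def)
    then show ?thesis using fin by (simp add: sum.union_disjoint)
  qed
  also have "sum w L = cnj (sum w U)"
    unfolding L_def by (subst sum.reindex) (auto simp: w_def mult.commute intro!: sum.cong)
  also have "sum w D = of_real (\<Sum>r<q. (cmod (\<Sum>n\<in>A r. z n))\<^sup>2)"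
  proof -
    have "sum w D = (\<Sum>r<q. sum w {p \<in> D. fst p mod q = r})"
      using q by (intro sum.group[symmetric] fin) auto
    also have "\<dots> = (\<Sum>r<q. of_real ((cmod (\<Sum>n\<in>A r. z n))\<^sup>2))"
    proof (rule sum.cong[OF refl])
      fix r assume "r \<in> {..<q}"
      have "{p \<in> D. fst p mod q = r} = A r \<times> A r" by (auto simp: D_def A_def)
      then have "sum w {p \<in> D. fst p mod q = r} = (\<Sum>n\<in>A r. z n) * cnj (\<Sum>n\<in>A r. z n)"
        by (simp add: sum_product w_def sum.cartesian_product)
      then show "sum w {p \<in> D. fst p mod q = r} = of_real ((cmod (\<Sum>n\<in>A r. z n))\<^sup>2)"
        by (simp only: complex_norm_square)
    qed
    finally show ?thesis by simp
  qed
  finally have "complex_of_real ((cmod (\<Sum>n<N. z n))\<^sup>2) =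
      of_real (\<Sum>r<q. (cmod (\<Sum>n\<in>A r. z n))\<^sup>2) + (sum w U + cnj (sum w U))" .
  then have "(cmod (\<Sum>n<N. z n))\<^sup>2 = (\<Sum>r<q. (cmod (\<Sum>n\<in>A r. z n))\<^sup>2) + 2 * Re (sum w U)"
    by (simp add: complex_eq_iff)
  also have "Re (sum w U) \<le> cmod (sum w U)" by (rule complex_Re_le_cmod)
  also have "sum w U = (\<Sum>h\<in>H. sum w {p \<in> U. fst p - snd p = h})"
  proof (rule sum.group[symmetric])
    show "(\<lambda>p. fst p - snd p) ` U \<subseteq> H"
      by (auto simp: U_def H_def mod_eq_dvd_iff_nat)
  qed (auto simp: fin H_def)
  also have "cmod \<dots> \<le> (\<Sum>h\<in>H. cmod (\<Sum>m<N-h. z (m + h) * cnj (z m)))"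
  proof (rule sum_norm_le)
    fix h assume h: "h \<in> H"
    have "{p \<in> U. fst p - snd p = h} = (\<lambda>m. (m + h, m)) ` {..<N-h}"
    proof (intro equalityI subsetI)
      fix p assume "p \<in> {p \<in> U. fst p - snd p = h}"
      then show "p \<in> (\<lambda>m. (m + h, m)) ` {..<N-h}"
        by (auto simp: U_def image_iff)
    next
      fix p assume "p \<in> (\<lambda>m. (m + h, m)) ` {..<N-h}"
      then obtain m where m: "p = (m + h, m)" "m < N - h" by auto
      have "(m + h) mod q \<noteq> m mod q"
        using h mod_eq_dvd_iff_nat[of m "m + h" q] by (auto simp: H_def)
      then show "p \<in> {p \<in> U. fst p - snd p = h}"
        using m h by (auto simp: U_def H_def)
    qed
    moreover have "inj_on (\<lambda>m. (m + h, m)) {..<N-h}" by (auto simp: inj_on_def)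
    ultimately show "cmod (sum w {p \<in> U. fst p - snd p = h}) \<le> cmod (\<Sum>m<N-h. z (m + h) * cnj (z m))"
      by (simp add: sum.reindex w_def)
  qed
  finally show ?thesis by (simp add: A_def H_def)
qed

section \<open>Geometric sums and reciprocals of residues\<close>

lemma norm_geometric_e_le:
  assumes "sin (pi * u) \<noteq> 0"
  shows "cmod (\<Sum>m<M. e (A + real m * u)) \<le> 1 / \<bar>sin (pi * u)\<bar>"
proof -
  have ne: "e u \<noteq> 1"
    using assms norm_e_minus_1[of u] by auto
  have "(\<Sum>m<M. e (A + real m * u)) = e A * ((e u ^ M - 1) / (e u - 1))"
    by (simp add: e_add e_of_nat_mult geometric_sum[OF ne] flip: sum_distrib_left)
  also have "cmod \<dots> = cmod (e u ^ M - 1) / (2 * \<bar>sin (pi * u)\<bar>)"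
    by (simp add: norm_mult norm_divide norm_e_minus_1)
  also have "\<dots> \<le> 2 / (2 * \<bar>sin (pi * u)\<bar>)"
    using norm_triangle_ineq4[of "e u ^ M" 1] by (intro divide_right_mono) (auto simp: norm_power)
  finally show ?thesis by simp
qed

text \<open>A square root in place of the logarithm is affordable: with denominators of order at
  most \<open>N\<close> it leads to an error of order \<open>N * sqrt N\<close>, which the threshold
  for \<open>L\<close> absorbs.\<close>

lemma harmonic_le_sqrt: "(\<Sum>j=1..n. 1 / real j) \<le> 2 * sqrt (real n)"
proof (induction n)
  case (Suc n)
  define s t where "s = sqrt (real n)" and "t = sqrt (real (Suc n))"
  have st: "0 \<le> s" "s \<le> t" "1 \<le> t" "t * t = real (Suc n)" "s * s = real n"
    by (auto simp: s_def t_def)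
  have "1 * t \<le> t * t" using st(3) by (intro mult_right_mono) auto
  then have "1 / (t * t) \<le> 1 / t" using st(3) by (simp add: divide_simps)
  also have "\<dots> \<le> 2 * (t - s)"
  proof -
    have "(t - s) * (t + s) = 1" using st by (simp add: algebra_simps)
    moreover have "(t - s) * (t + s) \<le> (t - s) * (2 * t)"
      using st by (intro mult_left_mono) auto
    ultimately show ?thesis using st by (simp add: field_simps)
  qed
  finally show ?case using Suc st by (simp add: s_def t_def)
qed simp

text \<open>As \<open>a\<close> is invertible modulo \<open>q\<close>, the residue \<open>j\<close>
  fixes \<open>h mod q\<close>, so \<open>h div q\<close> determines \<open>h\<close>.\<close>

lemma card_residue_le:
  fixes a :: int and q N :: nat
  assumes "coprime a (int q)" "q > 0"
  shows "card {h. h < N \<and> (int h * a) mod int q = j} \<le> N div q + 1"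
proof -
  let ?S = "{h. h < N \<and> (int h * a) mod int q = j}"
  have "inj_on (\<lambda>h. h div q) ?S"
  proof (rule inj_onI)
    fix h k assume h: "h \<in> ?S" "k \<in> ?S" "h div q = k div q"
    then have "[int h * a = int k * a] (mod int q)" by (auto simp: cong_def)
    then have "[int h = int k] (mod int q)"
      using assms(1) by (simp add: cong_mult_rcancel)
    then have "h mod q = k mod q" by (simp add: cong_def zmod_int[symmetric])
    then show "h = k" using h(3) by (metis div_mult_mod_eq)
  qed
  then have "card ?S \<le> card {..N div q}"
    by (rule card_inj_on_le) (auto simp: div_le_mono)
  then show ?thesis by simp
qed

text \<open>The summand dominates the reciprocal of the distance from \<open>i h / q\<close> to the
  nearest integer. Coprimality keeps \<open>i h\<close> away from zero and lets it take each value
  at most \<open>N div q + 1\<close> times; the symmetry \<open>j -> q - j\<close> then leaves twice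
  a harmonic sum.\<close>

lemma sum_reciprocal_residues_le:
  fixes a :: int and q N :: nat
  assumes a: "coprime a (int q)" and q: "q > 0"
    and i_def: "i = (\<lambda>h. nat ((int h * a) mod int q))"
  shows "(\<Sum>h | 0 < h \<and> h < N \<and> \<not> q dvd h. real q * (1 / real (i h) + 1 / real (q - i h)))
    \<le> 4 * real (N + q) * sqrt (real q)"
proof -
  define H where "H = {h. 0 < h \<and> h < N \<and> \<not> q dvd h}"
  define F where "F = (\<lambda>j. real q * (1 / real j + 1 / real (q - j)))"
  have F0: "F j \<ge> 0" for j by (simp add: F_def)
  have fH: "finite H" by (simp add: H_def)
  have iH: "i ` H \<subseteq> {1..<q}"
  proof
    fix j assume "j \<in> i ` H"
    then obtain h where h: "h \<in> H" "j = i h" by auto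
    have "\<not> int q dvd int h * a"
      using h(1) a by (auto simp: H_def coprime_dvd_mult_left_iff coprime_commute)
    then have "(int h * a) mod int q \<noteq> 0" by (simp add: dvd_eq_mod_eq_0)
    moreover have "(int h * a) mod int q \<ge> 0" "(int h * a) mod int q < int q" using q by auto
    ultimately show "j \<in> {1..<q}" by (auto simp: h i_def)
  qed
  have "(\<Sum>h\<in>H. F (i h)) = (\<Sum>j\<in>{1..<q}. \<Sum>h\<in>{h \<in> H. i h = j}. F (i h))"
    using iH by (intro sum.group[symmetric] fH) auto
  also have "\<dots> = (\<Sum>j\<in>{1..<q}. real (card {h \<in> H. i h = j}) * F j)"
    by (intro sum.cong) auto
  also have "\<dots> \<le> (\<Sum>j\<in>{1..<q}. real (N div q + 1) * F j)"
  proof (intro sum_mono mult_right_mono F0)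
    fix j assume "j \<in> {1..<q}"
    have "{h \<in> H. i h = j} \<subseteq> {h. h < N \<and> (int h * a) mod int q = int j}"
      using q by (auto simp: H_def i_def)
    then have "card {h \<in> H. i h = j} \<le> card {h. h < N \<and> (int h * a) mod int q = int j}"
      by (intro card_mono) auto
    also have "\<dots> \<le> N div q + 1" using a q by (rule card_residue_le)
    finally show "real (card {h \<in> H. i h = j}) \<le> real (N div q + 1)" by simp
  qed
  also have "\<dots> = real (N div q + 1) * real q * (\<Sum>j\<in>{1..<q}. 1 / real j + 1 / real (q - j))"
    by (simp add: F_def sum_distrib_left mult.assoc)
  also have "(\<Sum>j\<in>{1..<q}. 1 / real j + 1 / real (q - j)) = 2 * (\<Sum>j\<in>{1..<q}. 1 / real j)"
  proof -
    have "(\<Sum>j\<in>{1..<q}. 1 / real (q - j)) = (\<Sum>j\<in>{1..<q}. 1 / real j)"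
      by (rule sum.reindex_bij_witness[where i = "\<lambda>j. q - j" and j = "\<lambda>j. q - j"]) auto
    then show ?thesis by (simp add: sum.distrib)
  qed
  also have "(\<Sum>j\<in>{1..<q}. 1 / real j) \<le> 2 * sqrt (real q)"
  proof -
    have "{1..<q} = {1..q-1}" using q by auto
    then have "(\<Sum>j\<in>{1..<q}. 1 / real j) \<le> 2 * sqrt (real (q - 1))"
      using harmonic_le_sqrt[of "q - 1"] by simp
    also have "\<dots> \<le> 2 * sqrt (real q)" by simp
    finally show ?thesis .
  qed
  also have "real (N div q + 1) * real q \<le> real (N + q)"
  proof -
    have "(N div q + 1) * q \<le> N + q" by simp
    then show ?thesis by (metis of_nat_le_iff of_nat_mult)
  qed
  finally show ?thesis by (simp add: H_def F_def mult_left_mono mult_right_mono mult_ac)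
qed

section \<open>Large values force a rational approximation\<close>

text \<open>The correlation at distance \<open>h\<close> has a phase linear in \<open>m\<close> with
  slope \<open>2 h t\<close>, so it is a geometric sum; this is why \<open>2 t\<close>, not
  \<open>t\<close>, is approximated. Modulo integers the slope is
  \<open>(i h + h * \<theta>) / q\<close>, and \<open>|h * \<theta>| <= 1/8\<close> cannot bring the
  nonzero residue \<open>i h\<close> close to \<open>0\<close> or \<open>q\<close>. Finally
  \<open>q <= 8 N\<close> gives \<open>N + q <= 9 N\<close> and \<open>sqrt q <= 3 sqrt N\<close>,
  and \<open>4 * 9 * 3 = 108\<close>.\<close>

lemma offdiagonal_le:
  fixes a :: int and q N :: nat
  assumes a: "coprime a (int q)" and q: "q > 0" "q \<le> 8 * N" and N: "N > 0"
    and t: "\<bar>real q * (2 * t) - real_of_int a\<bar> \<le> 1 / (8 * real N)"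
    and f: "f = (\<lambda>n. real (Suc n) * x + (real (Suc n))\<^sup>2 * t)"
  shows "(\<Sum>h | 0 < h \<and> h < N \<and> \<not> q dvd h. cmod (\<Sum>m<N-h. e (f (m + h)) * cnj (e (f m))))
    \<le> 108 * (real N * sqrt (real N))"
proof -
  define i where "i = (\<lambda>h. nat ((int h * a) mod int q))"
  define \<theta> where "\<theta> = real q * (2 * t) - real_of_int a"
  have term_le: "cmod (\<Sum>m<N-h. e (f (m + h)) * cnj (e (f m)))
      \<le> real q * (1 / real (i h) + 1 / real (q - i h))"
    if h: "0 < h" "h < N" "\<not> q dvd h" for h
  proof -
    have "\<not> int q dvd int h * a"
      using h a by (auto simp: coprime_dvd_mult_left_iff coprime_commute)
    then have "(int h * a) mod int q \<noteq> 0" by (simp add: dvd_eq_mod_eq_0)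
    moreover have "(int h * a) mod int q \<ge> 0" "(int h * a) mod int q < int q" using q by auto
    ultimately have i: "0 < i h" "i h < q" "int (i h) = (int h * a) mod int q"
      by (auto simp: i_def)
    define k where "k = (int h * a) div int q"
    define v where "v = (real (i h) + real h * \<theta>) / real q"
    have "real_of_int (int h * a) = real q * of_int k + real (i h)"
      unfolding k_def using i(3) by (metis mult_div_mod_eq of_int_add of_int_mult of_int_of_nat_eq)
    then have u: "2 * real h * t = of_int k + v"
      using q by (simp add: v_def \<theta>_def field_simps)
    have "\<bar>real h * \<theta>\<bar> \<le> real N * (1 / (8 * real N))"
      unfolding abs_mult using h t by (intro mult_mono) (auto simp: \<theta>_def)
    then have h\<theta>: "\<bar>real h * \<theta>\<bar> \<le> 1/8" using N by simp
    define \<mu> where "\<mu> = min (real (i h)) (real q - real (i h))"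
    have \<mu>: "1 \<le> \<mu>" "\<mu> \<le> real (i h)" "\<mu> \<le> real q - real (i h)"
      using i by (auto simp: \<mu>_def)
    \<comment> \<open>\<open>\<mu>\<close> is the distance of \<open>i h\<close> to the multiples of
      \<open>q\<close> and is at least 1, so a perturbation of \<open>1/8\<close> costs at most an
      eighth of it.\<close>
    define d where "d = 7/8 * \<mu> / real q"
    have d0: "0 < d" using \<mu> q by (simp add: d_def)
    have "2 * d \<le> sin (pi * v)"
    proof (rule sin_pi_ge')
      have "7/8 * \<mu> \<le> real (i h) + real h * \<theta>" using \<mu> h\<theta> by linarith
      then show "d \<le> v" unfolding d_def v_def by (intro divide_right_mono) auto
      have "real (i h) + real h * \<theta> \<le> real q - 7/8 * \<mu>" using \<mu> h\<theta> by linarith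
      then have "v \<le> (real q - 7/8 * \<mu>) / real q" using q unfolding v_def by (intro divide_right_mono) auto
      also have "\<dots> = 1 - d" using q by (simp add: d_def diff_divide_distrib)
      finally show "v \<le> 1 - d" .
    qed (use d0 in auto)
    \<comment> \<open>The absolute sine is read off from the modulus of \<open>e u - 1\<close>,
      which does not see the integer \<open>k\<close>.\<close>
    moreover have "\<bar>sin (pi * (2 * real h * t))\<bar> = \<bar>sin (pi * v)\<bar>"
      using norm_e_minus_1[of "2 * real h * t"] norm_e_minus_1[of v] by (simp add: u e_add)
    ultimately have s: "2 * d \<le> \<bar>sin (pi * (2 * real h * t))\<bar>" by simp
    have "e (f (m + h)) * cnj (e (f m)) = e ((real h * x + (real h)\<^sup>2 * t + 2 * real h * t) + real m * (2 * real h * t))" for m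
      unfolding e_diff[symmetric] f by (rule arg_cong[where f = e]) (simp add: algebra_simps power2_eq_square)
    then have "cmod (\<Sum>m<N-h. e (f (m + h)) * cnj (e (f m))) \<le> 1 / \<bar>sin (pi * (2 * real h * t))\<bar>"
      using s d0 by (simp add: norm_geometric_e_le)
    also have "\<dots> \<le> 1 / (2 * d)" using s d0 by (intro divide_left_mono) auto
    also have "\<dots> \<le> real q * (1 / \<mu>)" using \<mu> q by (simp add: d_def field_simps)
    also have "1 / \<mu> \<le> 1 / real (i h) + 1 / real (q - i h)"
      using i by (auto simp: \<mu>_def min_def of_nat_diff)
    finally show ?thesis using q by (simp add: mult_left_mono)
  qed
  have "(\<Sum>h | 0 < h \<and> h < N \<and> \<not> q dvd h. cmod (\<Sum>m<N-h. e (f (m + h)) * cnj (e (f m))))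
    \<le> (\<Sum>h | 0 < h \<and> h < N \<and> \<not> q dvd h. real q * (1 / real (i h) + 1 / real (q - i h)))"
    by (intro sum_mono term_le) auto
  also have "\<dots> \<le> 4 * real (N + q) * sqrt (real q)"
    using a q(1) i_def by (rule sum_reciprocal_residues_le)
  also have "\<dots> \<le> 4 * (9 * real N) * (3 * sqrt (real N))"
  proof (intro mult_mono)
    have "sqrt (real q) \<le> sqrt (9 * real N)" using q by (intro real_sqrt_le_mono) linarith
    also have "\<dots> = 3 * sqrt (real N)" by (simp add: real_sqrt_mult)
    finally show "sqrt (real q) \<le> 3 * sqrt (real N)" .
  qed (use q in auto)
  finally show ?thesis by simp
qed

section \<open>Sums over a single residue class\<close>

lemma residue_class_enumeration:
  fixes q N r :: nat
  assumes "r < q"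
  obtains K where "\<And>g :: nat \<Rightarrow> complex. (\<Sum>n | n < N \<and> n mod q = r. g n) = (\<Sum>k<K. g (r + q * k))"
    "\<And>k. k < K \<Longrightarrow> r + q * k < N" "real K \<le> real N / real q + 1"
proof
  \<comment> \<open>The ceiling of \<open>(N - r) / q\<close>. If \<open>N <= r\<close>, truncated
    subtraction gives \<open>(q - 1) div q = 0\<close>, as it should for an empty class.\<close>
  define K where "K = (N - r + q - 1) div q"
  have q: "q > 0" using assms by simp
  have iff: "k < K \<longleftrightarrow> r + q * k < N" for k
  proof -
    have "k < K \<longleftrightarrow> Suc k * q \<le> N - r + q - 1"
      using q by (simp add: K_def less_eq_div_iff_mult_less_eq flip: Suc_le_eq)
    also have "\<dots> \<longleftrightarrow> r + q * k < N" using q by (auto simp: mult.commute)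
    finally show ?thesis .
  qed
  show "(\<Sum>n | n < N \<and> n mod q = r. g n) = (\<Sum>k<K. g (r + q * k))" for g :: "nat \<Rightarrow> complex"
  proof (rule sum.reindex_bij_witness[where i = "\<lambda>k. r + q * k" and j = "\<lambda>n. n div q"])
    fix n assume n: "n \<in> {n. n < N \<and> n mod q = r}"
    then show eq: "r + q * (n div q) = n" by auto
    show "n div q \<in> {..<K}" using n eq iff[of "n div q"] by simp
    show "g (r + q * (n div q)) = g n" by (simp only: eq)
  qed (use assms iff in auto)
  show "\<And>k. k < K \<Longrightarrow> r + q * k < N" using iff by simp
  show "real K \<le> real N / real q + 1"
  proof (cases K)
    case (Suc k)
    then have "q * k < N" using iff[of k] by simp
    then have "real q * real k \<le> real N" by (metis of_nat_le_iff of_nat_mult less_imp_le)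
    then show ?thesis using Suc q by (simp add: field_simps)
  qed simp
qed

text \<open>The parity of \<open>a * q * k\<close> is what forces the half-integer shift of \<open>x\<close>: as
  \<open>k\<^sup>2\<close> and \<open>k\<close> have the same parity, \<open>e (a * q * k\<^sup>2 / 2) = e (a * q * k / 2)\<close>.\<close>

lemma residue_class_sum:
  fixes a :: int and q N r :: nat
  assumes q: "q > 0" "q \<le> 8 * N" and N: "N > 0" and r: "r < q"
    and t: "\<theta> = real q * (2 * t) - real_of_int a" "\<bar>\<theta>\<bar> \<le> 1 / (8 * real N)"
    and f: "f = (\<lambda>n. real (Suc n) * x + (real (Suc n))\<^sup>2 * t)"
    and y: "y = real q * (x + real_of_int a / 2)"
    and W: "W = \<bar>y - of_int (round y)\<bar>" 
    and T: "T = (\<Sum>n | n < N \<and> n mod q = r. e (f n))"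
  shows "cmod T \<le> 9 * real N / real q"
    and "0 < W \<Longrightarrow> 4 * real N * \<bar>\<theta>\<bar> \<le> W \<and> cmod T \<le> 3 / W \<or>
      W < 4 * real N * \<bar>\<theta>\<bar> \<and> \<theta> \<noteq> 0 \<and> cmod T \<le> 15 / sqrt (real q * \<bar>\<theta>\<bar>)"
proof -
  obtain K where K: "\<And>g::nat\<Rightarrow>complex. (\<Sum>n | n < N \<and> n mod q = r. g n) = (\<Sum>k<K. g (r + q * k))"
    "\<And>k. k < K \<Longrightarrow> r + q * k < N" "real K \<le> real N / real q + 1"
    using residue_class_enumeration[OF r] by blast
  have "cmod T \<le> real K"
    unfolding T K(1) using sum_norm_le[of "{..<K}" "\<lambda>k. e (f (r + q * k))" "\<lambda>_. 1"] by simp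
  also have "\<dots> \<le> real N / real q + 1" by (rule K(3))
  also have "\<dots> \<le> 9 * real N / real q" using q by (simp add: field_simps)
  finally show "cmod T \<le> 9 * real N / real q" .
  assume W0: "0 < W"
  define s where "s = real (Suc r)"
  \<comment> \<open>The phase along the class, stripped of the constant \<open>C\<close> and of
    integers. Its second difference is \<open>real q * \<theta>\<close>; \<open>s\<close> is the
    first index of the class in the original numbering, which starts at 1.\<close>
  define \<phi> where "\<phi> = (\<lambda>k. y * real k + \<theta> * (s * real k + real q * (real k)\<^sup>2 / 2))"
  define C where "C = e (s * x + s\<^sup>2 * t)"
  have fe: "e (f (r + q * k)) = C * e (\<phi> k)" for k
  proof -
    have "even (k * (k - 1))" by auto
    then obtain j where j: "k * (k - 1) = 2 * j" by blast
    have J: "real j = ((real k)\<^sup>2 - real k) / 2"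
      using arg_cong[OF j, of real] by (cases k) (auto simp: power2_eq_square algebra_simps)
    have "\<phi> k + of_int (a * (int (Suc r) * int k + int q * int j))
      = real q * real k * x + (real_of_int a + \<theta>) * (s * real k) + real q * (real_of_int a + \<theta>) * (real k)\<^sup>2 / 2"
      unfolding \<phi>_def y of_int_mult of_int_add of_int_of_nat_eq J s_def[symmetric] by (simp add: field_simps)
    also have "real_of_int a + \<theta> = 2 * real q * t" using t by simp
    finally have "\<phi> k + of_int (a * (int (Suc r) * int k + int q * int j))
      = real q * real k * x + 2 * real q * t * (s * real k) + (real q)\<^sup>2 * t * (real k)\<^sup>2"
      by (simp add: power2_eq_square)
    moreover have "f (r + q * k) = (s + real q * real k) * x + (s + real q * real k)\<^sup>2 * t"
      by (simp add: f s_def add.assoc)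
    ultimately have "f (r + q * k) = (s * x + s\<^sup>2 * t) + \<phi> k + of_int (a * (int (Suc r) * int k + int q * int j))"
      by (simp add: power2_eq_square algebra_simps)
    then show ?thesis unfolding C_def by (simp only: e_add e_of_int mult_1_right)
  qed
  have "T = C * (\<Sum>k<K. e (\<phi> k))"
    unfolding T K(1) fe by (simp add: sum_distrib_left)
  then have Tn: "cmod T = cmod (\<Sum>k<K. e (\<phi> k))" by (simp add: norm_mult C_def)
  have N\<theta>: "real N * \<bar>\<theta>\<bar> \<le> 1/8"
    using mult_left_mono[OF t(2), of "real N"] N by simp
  have "4 * (real N * \<bar>\<theta>\<bar>) \<le> W \<and> cmod (\<Sum>k<K. e (\<phi> k)) \<le> 3 / W \<or>
    W < 4 * (real N * \<bar>\<theta>\<bar>) \<and> real q * \<theta> \<noteq> 0 \<and> cmod (\<Sum>k<K. e (\<phi> k)) \<le> 15 / sqrt \<bar>real q * \<theta>\<bar>"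
  proof (rule quadratic_sum_dichotomy[OF _ _ _ _ _ W W0])
    show "\<phi> (Suc k) - \<phi> k = (y + \<theta> * (s + real q / 2)) + real k * (real q * \<theta>)" for k
      by (simp add: \<phi>_def power2_eq_square algebra_simps)
    show "\<bar>real q * \<theta>\<bar> \<le> 1"
    proof -
      have "\<bar>real q * \<theta>\<bar> \<le> (8 * real N) * (1 / (8 * real N))"
        unfolding abs_mult using q t(2) by (intro mult_mono) auto
      then show ?thesis using N by simp
    qed
    show "real N * \<bar>\<theta>\<bar> \<le> 1 / 8" by (rule N\<theta>)
    show "real q * \<theta> = 0 \<Longrightarrow> real N * \<bar>\<theta>\<bar> = 0" using q by simp
    \<comment> \<open>The deviation from \<open>y\<close> is \<open>\<theta>\<close> times the
      midpoint of two consecutive indices of the class. Both indices are at most \<open>N\<close>,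
      hence so is their midpoint.\<close>
    show "\<bar>y + \<theta> * (s + real q / 2) + real k * (real q * \<theta>) - y\<bar> \<le> real N * \<bar>\<theta>\<bar>" if k: "Suc k < K" for k
    proof -
      have "r + q * Suc k < N" using K(2)[OF k] .
      then have "real (Suc (r + q * Suc k)) \<le> real N" by (simp only: of_nat_le_iff Suc_le_eq)
      then have "s + real q / 2 + real q * real k \<le> real N" by (simp add: s_def algebra_simps)
      moreover have "y + \<theta> * (s + real q / 2) + real k * (real q * \<theta>) - y = (s + real q / 2 + real q * real k) * \<theta>"
        by (simp add: algebra_simps)
      moreover have "0 \<le> s + real q / 2 + real q * real k" by (simp add: s_def)
      ultimately show ?thesis by (simp add: abs_mult mult_right_mono)
    qed
  qed
  then show "4 * real N * \<bar>\<theta>\<bar> \<le> W \<and> cmod T \<le> 3 / W \<or>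
      W < 4 * real N * \<bar>\<theta>\<bar> \<and> \<theta> \<noteq> 0 \<and> cmod T \<le> 15 / sqrt (real q * \<bar>\<theta>\<bar>)"
    unfolding Tn using q by (auto simp: abs_mult mult.assoc)
qed

text \<open>After differencing, the class sums carry at least half of \<open>L^2\<close>, so any
  bound uniform in the class limits \<open>L\<close>. The trivial bound limits \<open>q\<close>; the
  two alternatives for class sums limit either \<open>W\<close> directly, or \<open>\<theta>\<close>
  and through it \<open>W\<close>. The conclusion mentions neither \<open>t\<close> nor
  \<open>a\<close>.\<close>

lemma large_weyl_sum_approx:
  fixes N :: nat and L :: real
  assumes N: "N > 0" and L: "0 < L" "576 * (real N * sqrt (real N)) \<le> L\<^sup>2"
    and S: "L \<le> cmod (weyl_sum N x t)"
  obtains q :: nat and b :: int where "q \<ge> 1" "real q \<le> 3600 * (real N)\<^sup>2 / L\<^sup>2"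
    "\<bar>real q * x - real_of_int b\<bar> \<le> 3600 * real N / L\<^sup>2"
proof -
  have N8: "8 * N > 0" using N by simp
  obtain a k where ak: "coprime a k" "0 < k" "k \<le> int (8 * N)" 
    "\<bar>of_int k * (2 * t) - of_int a\<bar> < 1 / real (8 * N)"
    using Dirichlet_approx_coprime[OF N8, of "2 * t"] by metis
  define q where "q = nat k"
  have qk: "int q = k" "real_of_int k = real q" using ak(2) by (auto simp: q_def)
  define \<theta> where "\<theta> = real q * (2 * t) - real_of_int a"
  have q: "coprime a (int q)" "q > 0" "q \<le> 8 * N"
    using ak(1-3) unfolding qk(1)[symmetric] by auto
  have \<theta>: "\<bar>\<theta>\<bar> \<le> 1 / (8 * real N)"
    using ak(4) qk(2) by (simp add: \<theta>_def)
  define f where "f = (\<lambda>n. real (Suc n) * x + (real (Suc n))\<^sup>2 * t)"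
  define T where "T = (\<lambda>r. \<Sum>n | n < N \<and> n mod q = r. e (f n))"
  define y where "y = real q * (x + real_of_int a / 2)"
  define W where "W = \<bar>y - of_int (round y)\<bar>"
  \<comment> \<open>Doubling clears the half-integer shift in \<open>y\<close>:
    \<open>2 * q * x - b\<close> is twice \<open>y - round y\<close>. Hence the denominator produced
    is \<open>2 * q\<close>.\<close>
  define b where "b = 2 * round y - int q * a"
  have "weyl_sum N x t = (\<Sum>n<N. e (f n))"
    by (simp add: weyl_sum_def f_def sum.atLeast1_atMost_eq)
  then have "L\<^sup>2 \<le> (cmod (\<Sum>n<N. e (f n)))\<^sup>2"
    using S L by (intro power_mono) auto
  also have "\<dots> \<le> (\<Sum>r<q. (cmod (T r))\<^sup>2)
    + 2 * (\<Sum>h | 0 < h \<and> h < N \<and> \<not> q dvd h. cmod (\<Sum>m<N-h. e (f (m + h)) * cnj (e (f m))))"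
    unfolding T_def by (rule norm_sum_square_le_classes[OF q(2)])
  also have "\<dots> \<le> (\<Sum>r<q. (cmod (T r))\<^sup>2) + 2 * (108 * (real N * sqrt (real N)))"
    using offdiagonal_le[OF q N \<theta>[unfolded \<theta>_def] f_def] by simp
  \<comment> \<open>The off-diagonal part is at most \<open>216/576 = 3/8\<close> of
    \<open>L^2\<close>.\<close>
  finally have main: "L\<^sup>2 \<le> 2 * (\<Sum>r<q. (cmod (T r))\<^sup>2)" using L(2) zero_le_power2[of L] by linarith
  have bound: "L\<^sup>2 \<le> 2 * (real q * B\<^sup>2)" if "\<And>r. r < q \<Longrightarrow> cmod (T r) \<le> B" for B
  proof -
    have "(\<Sum>r<q. (cmod (T r))\<^sup>2) \<le> (\<Sum>r<q. B\<^sup>2)"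
      using that by (intro sum_mono power_mono) auto
    then show ?thesis using main by simp
  qed
  note T_le = residue_class_sum[OF q(2,3) N _ \<theta>_def \<theta> f_def y_def W_def]
  have "L\<^sup>2 \<le> 2 * (real q * (9 * real N / real q)\<^sup>2)"
    by (rule bound) (auto simp: T_def intro!: T_le(1))
  also have "\<dots> = 162 * (real N)\<^sup>2 / real q"
    using q by (simp add: power2_eq_square field_simps)
  finally have q_le: "real q \<le> 162 * (real N)\<^sup>2 / L\<^sup>2"
    using q L by (simp add: field_simps)
  \<comment> \<open>For \<open>W = 0\<close> there is nothing to show. The Kusmin-Landau alternative
    gives the constant 54, from \<open>18 * 162 = 54^2\<close>; the other one gives
    \<open>4 * 450 = 1800\<close>, which doubles to the 3600 of the conclusion.\<close>
  have W_le: "W \<le> 1800 * real N / L\<^sup>2"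
  proof (cases "W = 0")
    case False
    then have W0: "0 < W" by (auto simp: W_def)
    note T_le2 = T_le(2)[OF _ _ W0]
    show ?thesis
    proof (cases "4 * real N * \<bar>\<theta>\<bar> \<le> W")
      case True
      have "L\<^sup>2 \<le> 2 * (real q * (3 / W)\<^sup>2)"
      proof (rule bound)
        show "cmod (T r) \<le> 3 / W" if "r < q" for r
          using T_le2[OF that refl] True unfolding T_def by auto
      qed
      also have "\<dots> = 18 * real q / W\<^sup>2" by (simp add: power_divide)
      finally have "W\<^sup>2 \<le> 18 * real q / L\<^sup>2" using W0 L by (simp add: field_simps)
      also have "\<dots> \<le> 18 * (162 * (real N)\<^sup>2 / L\<^sup>2) / L\<^sup>2"
        using q_le by (intro divide_right_mono mult_left_mono) auto
      also have "\<dots> = (54 * real N / L\<^sup>2)\<^sup>2" by (simp add: power2_eq_square)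
      finally have "W \<le> 54 * real N / L\<^sup>2" by (rule power2_le_imp_le) simp
      also have "\<dots> \<le> 1800 * real N / L\<^sup>2" by (intro divide_right_mono) auto
      finally show ?thesis .
    next
      case False
      have \<theta>0: "\<theta> \<noteq> 0" using T_le2[OF q(2) refl] False by auto
      have "L\<^sup>2 \<le> 2 * (real q * (15 / sqrt (real q * \<bar>\<theta>\<bar>))\<^sup>2)"
      proof (rule bound)
        show "cmod (T r) \<le> 15 / sqrt (real q * \<bar>\<theta>\<bar>)" if "r < q" for r
          using T_le2[OF that refl] False unfolding T_def by auto
      qed
      also have "\<dots> = 450 / \<bar>\<theta>\<bar>" using q \<theta>0 by (simp add: power_divide)
      finally have "\<bar>\<theta>\<bar> \<le> 450 / L\<^sup>2" using \<theta>0 L by (simp add: field_simps)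
      then have "4 * real N * \<bar>\<theta>\<bar> \<le> 4 * real N * (450 / L\<^sup>2)" by (intro mult_left_mono) auto
      then show ?thesis using False by simp
    qed
  qed simp
  show thesis
  proof
    show "2 * q \<ge> 1" using q by simp
    show "real (2 * q) \<le> 3600 * (real N)\<^sup>2 / L\<^sup>2"
    proof -
      have "real (2 * q) \<le> 324 * (real N)\<^sup>2 / L\<^sup>2" using q_le by simp
      also have "\<dots> \<le> 3600 * (real N)\<^sup>2 / L\<^sup>2" by (intro divide_right_mono) auto
      finally show ?thesis .
    qed
    have "real (2 * q) * x - real_of_int b = 2 * (y - of_int (round y))"
      by (simp add: b_def y_def algebra_simps)
    then have "\<bar>real (2 * q) * x - real_of_int b\<bar> = 2 * W" by (simp only: W_def abs_mult abs_numeral)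
    then show "\<bar>real (2 * q) * x - real_of_int b\<bar> \<le> 3600 * real N / L\<^sup>2"
      using W_le by simp
  qed
qed

section \<open>The maximal function\<close>

text \<open>Leaving out the power \<open>p\<close> gives one function for all moments, Lipschitz in
  \<open>x\<close>, whose level sets do not depend on \<open>p\<close>.\<close>

definition maximal_sum :: "nat \<Rightarrow> real \<Rightarrow> real" where
  "maximal_sum N x = (SUP t\<in>{0..1}. cmod (weyl_sum N x t))"

lemma maximal_sum_attained:
  obtains t where "t \<in> {0..1}" "maximal_sum N x = cmod (weyl_sum N x t)"
    "\<And>s. s \<in> {0..1} \<Longrightarrow> cmod (weyl_sum N x s) \<le> maximal_sum N x"
  using weyl_sum_max_attained[of 1 N x] by (auto simp: maximal_sum_def)

lemma norm_weyl_sum_le: "cmod (weyl_sum N x t) \<le> real N"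
  unfolding weyl_sum_def
  using sum_norm_le[of "{1..N}" "\<lambda>n. e (real n * x + (real n)\<^sup>2 * t)" "\<lambda>_. 1"] by simp

lemma maximal_sum_upper: "t \<in> {0..1} \<Longrightarrow> cmod (weyl_sum N x t) \<le> maximal_sum N x"
  by (metis maximal_sum_attained)

lemma maximal_sum_nonneg: "0 \<le> maximal_sum N x"
  by (metis maximal_sum_attained norm_ge_zero)

lemma maximal_sum_le: "maximal_sum N x \<le> real N"
  by (metis maximal_sum_attained norm_weyl_sum_le)

lemma SUP_powr_weyl_sum:
  assumes "p \<ge> 1"
  shows "(SUP t\<in>{0..1}. cmod (weyl_sum N x t) powr p) = maximal_sum N x powr p"
proof -
  obtain t where t: "t \<in> {0..1}" "maximal_sum N x = cmod (weyl_sum N x t)"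
    by (metis maximal_sum_attained)
  show ?thesis
  proof (rule cSup_eq_maximum)
    show "maximal_sum N x powr p \<in> (\<lambda>t. cmod (weyl_sum N x t) powr p) ` {0..1}"
      using t by auto
  qed (use assms in \<open>auto intro!: powr_mono2 maximal_sum_upper\<close>)
qed

lemma norm_e_diff_le: "cmod (e u - e v) \<le> 2 * pi * \<bar>u - v\<bar>"
proof -
  have "e u - e v = e v * (e (u - v) - 1)"
    using e_add[of v "u - v"] by (simp add: right_diff_distrib)
  then show ?thesis using norm_e_minus_1_le[of "u - v"] by (simp add: norm_mult)
qed

lemma weyl_sum_lipschitz: "cmod (weyl_sum N x t - weyl_sum N y t) \<le> 2 * pi * (real N)\<^sup>2 * \<bar>x - y\<bar>"
proof -
  have "cmod (weyl_sum N x t - weyl_sum N y t) \<le> (\<Sum>n=1..N. 2 * pi * (real N * \<bar>x - y\<bar>))"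
    unfolding weyl_sum_def sum_subtractf[symmetric]
  proof (rule sum_norm_le)
    fix n assume n: "n \<in> {1..N}"
    have "cmod (e (real n * x + (real n)\<^sup>2 * t) - e (real n * y + (real n)\<^sup>2 * t)) 
      \<le> 2 * pi * \<bar>(real n * x + (real n)\<^sup>2 * t) - (real n * y + (real n)\<^sup>2 * t)\<bar>"
      by (rule norm_e_diff_le)
    also have "(real n * x + (real n)\<^sup>2 * t) - (real n * y + (real n)\<^sup>2 * t) = real n * (x - y)"
      by (simp add: algebra_simps)
    also have "2 * pi * \<bar>real n * (x - y)\<bar> \<le> 2 * pi * (real N * \<bar>x - y\<bar>)"
      using n by (simp add: abs_mult mult_right_mono)
    finally show "cmod (e (real n * x + (real n)\<^sup>2 * t) - e (real n * y + (real n)\<^sup>2 * t)) 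
      \<le> 2 * pi * (real N * \<bar>x - y\<bar>)" .
  qed
  then show ?thesis by (simp add: power2_eq_square mult_ac)
qed

text \<open>The Lipschitz constant in \<open>x\<close> is the same for every \<open>t\<close>, so it
  passes to the supremum: evaluate at the maximiser for one point and compare at the other.\<close>

lemma continuous_on_maximal_sum: "continuous_on A (maximal_sum N)"
proof -
  have le: "maximal_sum N x \<le> maximal_sum N y + 2 * pi * (real N)\<^sup>2 * \<bar>x - y\<bar>" for x y
  proof -
    obtain t where t: "t \<in> {0..1}" "maximal_sum N x = cmod (weyl_sum N x t)"
      by (metis maximal_sum_attained)
    have "cmod (weyl_sum N x t) \<le> cmod (weyl_sum N y t) + cmod (weyl_sum N x t - weyl_sum N y t)"
      by (metis add.commute diff_add_cancel norm_triangle_ineq)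
    also have "\<dots> \<le> maximal_sum N y + 2 * pi * (real N)\<^sup>2 * \<bar>x - y\<bar>"
      using t by (intro add_mono maximal_sum_upper weyl_sum_lipschitz)
    finally show ?thesis using t by simp
  qed
  have "(2 * pi * (real N)\<^sup>2)-lipschitz_on A (maximal_sum N)"
  proof (rule lipschitz_onI)
    show "dist (maximal_sum N x) (maximal_sum N y) \<le> 2 * pi * (real N)\<^sup>2 * dist x y" for x y
      using le[of x y] le[of y x] by (simp add: dist_real_def abs_le_iff abs_minus_commute)
  qed simp
  then show ?thesis by (rule lipschitz_on_continuous_on)
qed

lemma integrable_maximal_sum_powr:
  assumes "p \<ge> 1"
  shows "(\<lambda>x. maximal_sum N x powr p) integrable_on {a..b}"
  using assms
  by (intro integrable_continuous_interval continuous_on_powr' continuous_on_maximal_sum continuous_on_const)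
    (auto simp: maximal_sum_nonneg)

lemma maximal_moment_eq:
  assumes "p \<ge> 1"
  shows "maximal_moment p N = integral {0..1} (\<lambda>x. maximal_sum N x powr p)"
  by (simp add: maximal_moment_def SUP_powr_weyl_sum[OF assms])

section \<open>Upper bound\<close>

text \<open>The level set is enclosed in a finite union of intervals, one for each admissible
  fraction. A denominator \<open>q\<close> admits \<open>q + 15 <= 16 q\<close> numerators with
  intervals of length \<open>2 R / q\<close>, so it costs at most \<open>32 R\<close>; the constant
  is \<open>32 * 3600^2\<close>.\<close>

lemma level_set_cover:
  fixes N :: nat and L :: real
  assumes N: "N > 0" and L: "0 < L" "576 * (real N * sqrt (real N)) \<le> L\<^sup>2"
  obtains A :: "real set" where "A \<in> lmeasurable" "\<And>x. x \<in> {0..1} \<Longrightarrow> L \<le> maximal_sum N x \<Longrightarrow> x \<in> A"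
    "measure lebesgue A \<le> 414720000 * real N ^ 3 / L ^ 4"
proof
  define R where "R = 3600 * real N / L\<^sup>2"
  define Q where "Q = nat \<lfloor>3600 * (real N)\<^sup>2 / L\<^sup>2\<rfloor>"
  define I where "I = (\<lambda>(q, b). {(real_of_int b - R) / real q .. (real_of_int b + R) / real q})"
  \<comment> \<open>The margin 7 is a bound for \<open>R\<close>: since \<open>L^2 >= 576 N\<close>,
    \<open>R\<close> is at most \<open>3600 / 576 < 7\<close>.\<close>
  define B where "B = (SIGMA q:{1..Q}. {-7..int q + 7})"
  define A where "A = (\<Union>p\<in>B. I p)"
  have R0: "0 \<le> R" by (simp add: R_def)
  have "real N * 576 \<le> 576 * (real N * sqrt (real N))" using N by simp
  then have "3600 * real N \<le> 7 * L\<^sup>2" using L(2) by linarith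
  then have R7: "R \<le> 7" using L(1) by (simp add: R_def field_simps)
  have finB: "finite B" by (simp add: B_def)
  have I_meas: "I p \<in> lmeasurable" for p by (cases p) (simp add: I_def)
  show "A \<in> lmeasurable"
    unfolding A_def by (intro fmeasurable.finite_UN finB I_meas)
  show "x \<in> A" if x: "x \<in> {0..1}" "L \<le> maximal_sum N x" for x
  proof -
    obtain t where "maximal_sum N x = cmod (weyl_sum N x t)" by (metis maximal_sum_attained)
    then have "L \<le> cmod (weyl_sum N x t)" using x by simp
    from large_weyl_sum_approx[OF N L this]
    obtain q b where q: "q \<ge> 1" "real q \<le> 3600 * (real N)\<^sup>2 / L\<^sup>2" "\<bar>real q * x - real_of_int b\<bar> \<le> R"
      unfolding R_def by metis
    have "q \<le> Q" using q(2) by (simp add: Q_def le_nat_floor)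
    moreover have "0 \<le> real q * x" "real q * x \<le> real q" using x(1) by (auto simp: mult_left_le)
    then have "-7 \<le> real_of_int b" "real_of_int b \<le> real q + 7" using q(3) R7 by linarith+
    then have "-7 \<le> b" "b \<le> int q + 7" by linarith+
    moreover have "x \<in> I (q, b)"
      using q(1,3) by (auto simp: I_def field_simps abs_le_iff)
    ultimately show "x \<in> A"
      unfolding A_def B_def using q(1) by (intro UN_I[of "(q, b)"] SigmaI) auto
  qed
  have "measure lebesgue A \<le> (\<Sum>p\<in>B. measure lebesgue (I p))"
    unfolding A_def by (intro measure_UNION_le finB fmeasurableD I_meas)
  also have "\<dots> = (\<Sum>(q, b)\<in>B. 2 * R / real q)"
  proof (rule sum.cong[OF refl])
    fix p assume "p \<in> B"
    then show "measure lebesgue (I p) = (case p of (q, b) \<Rightarrow> 2 * R / real q)"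
      using R0 by (cases p) (auto simp: I_def B_def diff_divide_distrib add_divide_distrib)
  qed
  also have "\<dots> = (\<Sum>q=1..Q. \<Sum>b\<in>{-7..int q + 7}. 2 * R / real q)"
    unfolding B_def by (subst sum.Sigma) auto
  also have "\<dots> \<le> (\<Sum>q=1..Q. 32 * R)"
  proof (rule sum_mono)
    fix q assume q: "q \<in> {1..Q}"
    have "(real q + 15) * R \<le> (16 * real q) * R"
      using q R0 by (intro mult_right_mono) auto
    then show "(\<Sum>b\<in>{-7..int q + 7}. 2 * R / real q) \<le> 32 * R"
      using q by (simp add: field_simps)
  qed
  also have "\<dots> = real Q * (32 * R)" by simp
  also have "\<dots> \<le> (3600 * (real N)\<^sup>2 / L\<^sup>2) * (32 * R)"
    using R0 by (intro mult_right_mono) (auto simp: Q_def)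
  also have "\<dots> = 414720000 * real N ^ 3 / L ^ 4"
    by (simp add: R_def power2_eq_square power3_eq_cube power4_eq_xxxx)
  finally show "measure lebesgue A \<le> 414720000 * real N ^ 3 / L ^ 4" .
qed

lemma powr_mult_powr_minus_4:
  assumes "0 < (x::real)"
  shows "(2 * x) powr p / x ^ 4 = 2 powr p * x powr (p - 4)"
  using assms by (simp add: powr_mult powr_diff powr_numeral)

text \<open>A discrete layer-cake estimate. On the scale between \<open>l j\<close> and
  \<open>l (Suc j) = 2 * l j\<close> the integrand is at most \<open>l (Suc j) powr p\<close>, and
  the points concerned lie in the cover of the level set at \<open>l j\<close>. Scales beyond
  \<open>N\<close> do not occur, because the Weyl sum has \<open>N\<close> terms of modulus
  1.\<close>

lemma moment_le_levels:
  fixes N :: nat and p :: real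
  assumes p: "p \<ge> 1" and N: "N > 0" and l: "l = (\<lambda>j::nat. 24 * real N powr (3/4) * 2 ^ j)"
  obtains J where "\<And>j. j < J \<Longrightarrow> l j \<le> real N"
    "maximal_moment p N \<le> l 0 powr p + 414720000 * 2 powr p * (real N ^ 3 * (\<Sum>j<J. l j powr (p - 4)))"
proof
  define J where "J = (LEAST j. real N < l j)"
  have l0: "0 < l j" for j using N by (simp add: l)
  have l_Suc: "l (Suc j) = 2 * l j" for j by (simp add: l)
  have l_mono: "l i \<le> l j" if "i \<le> j" for i j
    unfolding l using that by (intro mult_left_mono power_increasing) auto
  have "\<exists>j. real N < 2 ^ j" by (rule real_arch_pow) simp
  then obtain j where "real N < 2 ^ j" by blast
  also have "(2::real) ^ j \<le> l j"
  proof -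
    have "1 \<le> real N powr (3/4)" using N by (simp add: ge_one_powr_ge_zero)
    then have "1 * 2 ^ j \<le> (24 * real N powr (3/4)) * 2 ^ j" by (intro mult_right_mono) auto
    then show ?thesis by (simp add: l)
  qed
  finally have J: "real N < l J" unfolding J_def by (rule LeastI)
  show J': "l j \<le> real N" if "j < J" for j
    using not_less_Least[OF that[unfolded J_def]] by simp
  have l_sq: "576 * (real N * sqrt (real N)) \<le> (l j)\<^sup>2" for j
  proof -
    have "(real N powr (3/4))\<^sup>2 = real N * sqrt (real N)"
      using N by (simp add: powr_half_sqrt[symmetric] powr_add[symmetric] powr_mult_base power2_eq_square)
    then have "(l 0)\<^sup>2 = 576 * (real N * sqrt (real N))" by (simp add: l power_mult_distrib)
    moreover have "(l 0)\<^sup>2 \<le> (l j)\<^sup>2" using l_mono[of 0 j] l0[of 0] by (intro power_mono) auto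
    ultimately show ?thesis by simp
  qed
  have "\<exists>A. A \<in> lmeasurable \<and> (\<forall>x\<in>{0..1}. l j \<le> maximal_sum N x \<longrightarrow> x \<in> A) \<and>
    measure lebesgue A \<le> 414720000 * real N ^ 3 / l j ^ 4" for j
    by (rule level_set_cover[OF N l0[of j] l_sq]) blast
  then obtain A where A: "\<And>j. A j \<in> lmeasurable"
    "\<And>j x. x \<in> {0..1} \<Longrightarrow> l j \<le> maximal_sum N x \<Longrightarrow> x \<in> A j"
    "\<And>j. measure lebesgue (A j) \<le> 414720000 * real N ^ 3 / l j ^ 4"
    by metis
  define g where "g = (\<lambda>x. l 0 powr p + (\<Sum>j<J. l (Suc j) powr p * indicat_real (A j) x))"
  have meas: "{0..1} \<inter> A j \<in> lmeasurable" "A j \<inter> {0..1} \<in> lmeasurable" for j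
    using A(1) by (auto intro: fmeasurable_Int_fmeasurable lmeasurable_interval)
  have int_ind: "indicat_real (A j) integrable_on {0..1}" for j
    using meas by (simp add: integrable_on_indicator)
  have pointwise: "maximal_sum N x powr p \<le> g x" if x: "x \<in> {0..1}" for x
  proof (cases "maximal_sum N x < l 0")
    case True
    then have "maximal_sum N x powr p \<le> l 0 powr p"
      using p by (intro powr_mono2) (auto simp: maximal_sum_nonneg)
    also have "\<dots> \<le> g x" unfolding g_def by (auto intro!: sum_nonneg)
    finally show ?thesis .
  next
    case False
    \<comment> \<open>The first level above the value is not level 0, so its predecessor
      \<open>i\<close> is still reached and places \<open>x\<close> in \<open>A i\<close>.\<close>
    define k where "k = (LEAST j. maximal_sum N x < l j)"
    have lt: "maximal_sum N x < l J" using J maximal_sum_le[of N x] by linarith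
    have k: "maximal_sum N x < l k" unfolding k_def by (rule LeastI[of "\<lambda>j. maximal_sum N x < l j", OF lt])
    have "k \<le> J" unfolding k_def by (rule Least_le[of "\<lambda>j. maximal_sum N x < l j", OF lt])
    obtain i where i: "k = Suc i" using k False by (cases k) auto
    have "l i \<le> maximal_sum N x"
      using not_less_Least[of i "\<lambda>j. maximal_sum N x < l j"] i by (simp add: k_def)
    then have xA: "x \<in> A i" using A(2) x by blast
    have "maximal_sum N x powr p \<le> l (Suc i) powr p"
      using p k i by (intro powr_mono2) (auto simp: maximal_sum_nonneg)
    also have "\<dots> = l (Suc i) powr p * indicat_real (A i) x" using xA by simp
    also have "\<dots> \<le> (\<Sum>j<J. l (Suc j) powr p * indicat_real (A j) x)"
      using \<open>k \<le> J\<close> i by (intro member_le_sum) auto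
    also have "\<dots> \<le> g x" by (simp add: g_def)
    finally show ?thesis .
  qed
  have int_sum: "(\<lambda>x. \<Sum>j<J. l (Suc j) powr p * indicat_real (A j) x) integrable_on {0..1}"
    by (intro integrable_sum integrable_on_mult_right int_ind) auto
  have "maximal_moment p N \<le> integral {0..1} g"
    unfolding maximal_moment_eq[OF p] g_def
    using pointwise unfolding g_def
    by (intro integral_le integrable_maximal_sum_powr p integrable_add int_sum) auto
  also have "\<dots> = l 0 powr p + integral {0..1} (\<lambda>x. \<Sum>j<J. l (Suc j) powr p * indicat_real (A j) x)"
    unfolding g_def using int_sum by (subst integral_add) (simp_all add: integrable_const_ivl del: sum_mult_indicator)
  also have "integral {0..1} (\<lambda>x. \<Sum>j<J. l (Suc j) powr p * indicat_real (A j) x)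
    = (\<Sum>j<J. l (Suc j) powr p * measure lebesgue (A j \<inter> {0..1}))"
    by (subst integral_sum) (auto intro!: integrable_on_mult_right int_ind sum.cong simp: integral_indicator meas)
  also have "\<dots> \<le> (\<Sum>j<J. l (Suc j) powr p * (414720000 * real N ^ 3 / l j ^ 4))"
  proof (intro sum_mono mult_left_mono)
    fix j
    have "measure lebesgue (A j \<inter> {0..1}) \<le> measure lebesgue (A j)"
      using A(1)[of j] meas[of j] by (intro measure_mono_fmeasurable) (auto intro: fmeasurableD)
    then show "measure lebesgue (A j \<inter> {0..1}) \<le> 414720000 * real N ^ 3 / l j ^ 4"
      using A(3)[of j] by linarith
  qed auto
  also have "\<dots> = (\<Sum>j<J. 414720000 * real N ^ 3 * ((2 * l j) powr p / l j ^ 4))"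
    by (intro sum.cong refl) (simp add: l_Suc mult_ac)
  also have "\<dots> = 414720000 * 2 powr p * (real N ^ 3 * (\<Sum>j<J. l j powr (p - 4)))"
    unfolding powr_mult_powr_minus_4[OF l0] by (simp add: sum_distrib_left sum_distrib_right mult_ac)
  finally show "maximal_moment p N \<le> l 0 powr p + 414720000 * 2 powr p * (real N ^ 3 * (\<Sum>j<J. l j powr (p - 4)))"
    by simp
qed

section \<open>Lower bound\<close>

lemma sum_periodic_shift:
  fixes g :: "nat \<Rightarrow> complex"
  assumes "\<And>n. g (n + P) = g n"
  shows "(\<Sum>n<P. g (n + m)) = (\<Sum>n<P. g n)"
proof (induction m)
  case (Suc m)
  have "g (P + m) = g m" using assms[of m] by (simp add: add.commute)
  then have "(\<Sum>n<P. g (Suc n + m)) = (\<Sum>n<P. g (n + m))"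
    using sum.lessThan_Suc_shift[of "\<lambda>n. g (n + m)" P] sum.lessThan_Suc[of "\<lambda>n. g (n + m)" P]
    by simp
  then show ?case using Suc by simp
qed simp

text \<open>The phase of the Weyl sum at \<open>x = b / q\<close>, \<open>t = 1 / (4 q)\<close>. The
  4 makes the period \<open>2 * q\<close> for every \<open>b\<close>, odd or even \<open>q\<close>
  alike: a shift by \<open>2 * q\<close> adds the integer \<open>2 * b + n + q\<close>.\<close>

definition gauss_phase :: "nat \<Rightarrow> int \<Rightarrow> nat \<Rightarrow> real" where
  "gauss_phase q b n = real n * (real_of_int b / real q) + (real n)\<^sup>2 * (1 / (4 * real q))"

lemma e_gauss_phase_periodic:
  assumes "q > 0"
  shows "e (gauss_phase q b (n + 2 * q)) = e (gauss_phase q b n)"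
proof -
  have "gauss_phase q b (n + 2 * q) = gauss_phase q b n + of_int (2 * b + int n + int q)"
    using assms by (simp add: gauss_phase_def field_simps power2_eq_square)
  then show ?thesis by (simp only: e_add e_of_int mult_1_right)
qed

text \<open>The square of the modulus is a sum of autocorrelations. The one at shift
  \<open>h\<close> is \<open>u h\<close> times a complete sum of the character
  \<open>m -> e (m * h / (2 * q))\<close>, which vanishes unless \<open>h = 0\<close>. Only the
  factor \<open>u h\<close> involves \<open>b\<close>, so the modulus is exact for every
  \<open>b\<close>.\<close>

lemma gauss_sum_norm:
  assumes q: "q > 0"
  shows "cmod (\<Sum>n<2*q. e (gauss_phase q b n)) = sqrt (real (2 * q))"
proof -
  define P where "P = 2 * q"
  define u where "u = (\<lambda>n. e (gauss_phase q b n))"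
  have per: "u (n + P) = u n" for n
    unfolding u_def P_def by (rule e_gauss_phase_periodic[OF q])
  have orth: "(\<Sum>m<P. e (real m * (real h / real P))) = (if h = 0 then of_nat P else 0)" if "h < P" for h
  proof (cases "h = 0")
    case False
    have "sin (pi * (real h / real P)) > 0"
      using False that by (intro sin_gt_zero) (auto simp: field_simps)
    then have ne: "e (real h / real P) \<noteq> 1"
      using norm_e_minus_1[of "real h / real P"] by auto
    have "e (real h / real P) ^ P = e (of_int (int h))"
      using that unfolding e_of_nat_mult[symmetric] by simp
    then have one: "e (real h / real P) ^ P = 1" by (simp only: e_of_int)
    show ?thesis
      unfolding e_of_nat_mult geometric_sum[OF ne] one using False by simp
  qed simp
  have corr: "u (h + m) * cnj (u m) = u h * e (real m * (real h / real P))" for h m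
  proof -
    have "gauss_phase q b (h + m) - gauss_phase q b m = gauss_phase q b h + real m * (real h / real P)"
      using q by (simp add: gauss_phase_def P_def field_simps power2_eq_square)
    then show ?thesis unfolding u_def by (simp only: e_diff[symmetric] e_add[symmetric])
  qed
  have "complex_of_real ((cmod (\<Sum>n<P. u n))\<^sup>2) = (\<Sum>n<P. u n) * (\<Sum>m<P. cnj (u m))"
    using complex_norm_square[of "\<Sum>n<P. u n"] by simp
  also have "\<dots> = (\<Sum>m<P. (\<Sum>n<P. u n) * cnj (u m))"
    by (rule sum_distrib_left)
  also have "\<dots> = (\<Sum>m<P. (\<Sum>h<P. u (h + m)) * cnj (u m))"
    by (simp only: sum_periodic_shift[of u P, OF per])
  also have "\<dots> = (\<Sum>m<P. \<Sum>h<P. u h * e (real m * (real h / real P)))"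
    by (simp only: sum_distrib_right corr)
  also have "\<dots> = (\<Sum>h<P. u h * (\<Sum>m<P. e (real m * (real h / real P))))"
    by (subst sum.swap) (simp add: sum_distrib_left)
  also have "\<dots> = (\<Sum>h<P. if h = 0 then u h * of_nat P else 0)"
    using orth by (intro sum.cong refl) (simp del: times_divide_eq_right)
  also have "\<dots> = of_nat P"
    using q by (simp add: sum.delta P_def u_def gauss_phase_def)
  finally have "complex_of_real ((cmod (\<Sum>n<P. u n))\<^sup>2) = complex_of_real (real P)" by simp
  then have "(cmod (\<Sum>n<P. u n))\<^sup>2 = real P" by (simp only: of_real_eq_iff)
  then show ?thesis unfolding u_def P_def by (metis norm_ge_zero real_sqrt_unique)
qed

lemma sum_full_periods:
  fixes g :: "nat \<Rightarrow> complex"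
  assumes per: "\<And>n. g (n + P) = g n" 
  shows "(\<Sum>n<k * P + r. g n) = of_nat k * (\<Sum>n<P. g n) + (\<Sum>n<r. g n)"
proof (induction k)
  case (Suc k)
  have sh: "(\<Sum>n<P + M. g n) = (\<Sum>n<P. g n) + (\<Sum>n<M. g n)" for M
    by (induction M) (simp_all add: per add.commute[of P] add.assoc)
  show ?case using sh[of "k * P + r"] Suc by (simp add: algebra_simps)
qed simp

text \<open>Each full period contributes the same Gauss sum of modulus \<open>sqrt P\<close>, so the
  main terms add up without cancellation; the incomplete period and the rounding of
  \<open>M / P\<close> cost at most \<open>P\<close> each.\<close>

lemma gauss_partial_sum:
  assumes q: "q > 0"
  defines "P \<equiv> 2 * q"
  shows "cmod (\<Sum>n<M. e (gauss_phase q b (Suc n))) \<le> real M / sqrt (real P) + real P"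
    and "real M / sqrt (real P) - 2 * real P \<le> cmod (\<Sum>n<M. e (gauss_phase q b (Suc n)))"
proof -
  define g where "g = (\<lambda>n. e (gauss_phase q b (Suc n)))"
  define s where "s = sqrt (real P)"
  have P: "P \<ge> 1" using q by (simp add: P_def)
  have s: "1 \<le> s" "s * s = real P" "s \<le> real P" using P by (auto simp: s_def sqrt_le_D real_sqrt_le_iff real_le_lsqrt power2_eq_square)
  have per: "g (n + P) = g n" for n
    using e_gauss_phase_periodic[OF q, of b "Suc n"] by (simp add: g_def P_def)
  have G: "cmod (\<Sum>n<P. g n) = s"
    using sum_periodic_shift[of "\<lambda>n. e (gauss_phase q b n)" P 1] e_gauss_phase_periodic[OF q, of b]
      gauss_sum_norm[OF q, of b] by (simp add: g_def P_def s_def)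
  define k where "k = M div P"
  define r where "r = M mod P"
  have M: "M = k * P + r" "r < P" using P by (auto simp: k_def r_def)
  have r: "cmod (\<Sum>n<r. g n) \<le> real P"
    using sum_norm_le[of "{..<r}" g "\<lambda>_. 1"] M(2) by (simp add: g_def)
  have eq: "(\<Sum>n<M. g n) = of_nat k * (\<Sum>n<P. g n) + (\<Sum>n<r. g n)"
    unfolding M(1) by (rule sum_full_periods[of g P k r, OF per])
  have kG: "cmod (of_nat k * (\<Sum>n<P. g n)) = real k * s" by (simp add: norm_mult G)
  have rM: "real M = real k * real P + real r" using M(1) by (metis of_nat_add of_nat_mult)
  have Ms: "real M / s = real k * s + real r / s"
    unfolding rM using s by (simp add: field_simps flip: s(2))
  have "real r / s \<le> real r / 1" using s by (intro divide_left_mono) auto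
  then have rs: "0 \<le> real r / s" "real r / s \<le> real P" using M(2) s by auto
  have "cmod (\<Sum>n<M. g n) \<le> real k * s + real P"
    using norm_triangle_ineq[of "of_nat k * (\<Sum>n<P. g n)" "\<Sum>n<r. g n"] r unfolding eq kG by linarith
  then show "cmod (\<Sum>n<M. e (gauss_phase q b (Suc n))) \<le> real M / sqrt (real P) + real P"
    using Ms rs unfolding g_def s_def by linarith
  have "real k * s - real P \<le> cmod (\<Sum>n<M. g n)"
    using norm_diff_ineq[of "of_nat k * (\<Sum>n<P. g n)" "\<Sum>n<r. g n"] r unfolding eq kG by linarith
  then show "real M / sqrt (real P) - 2 * real P \<le> cmod (\<Sum>n<M. e (gauss_phase q b (Suc n)))"
    using Ms rs unfolding g_def s_def by linarith
qed

section \<open>Large values near rational points\<close>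

lemma summation_by_parts:
  fixes a w :: "nat \<Rightarrow> complex"
  shows "(\<Sum>n<N. a n * w n) = (\<Sum>n<N. a n) * w N - (\<Sum>n<N. (\<Sum>k<Suc n. a k) * (w (Suc n) - w n))"
  by (induction N) (simp_all add: algebra_simps)

text \<open>With \<open>x = b / q + \<beta>\<close> the Weyl sum at \<open>t = 1 / (4 q)\<close> is
  a Gauss sum with the slowly varying weight \<open>w\<close>. The total variation of
  \<open>w\<close> is at most \<open>2 * pi / 40 <= 1/6\<close>, so summation by parts loses only a
  sixth of the largest partial sum.\<close>

lemma maximal_sum_major_arc:
  fixes q N :: nat and b :: int
  assumes q: "q > 0" "q\<^sup>2 \<le> N" and N: "N \<ge> 262144" 
    and x: "\<bar>x - real_of_int b / real q\<bar> \<le> 1 / (40 * real N)"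
  shows "real N / (2 * sqrt (real (2 * q))) \<le> maximal_sum N x"
proof -
  define P where "P = 2 * q"
  define s where "s = sqrt (real P)"
  define X where "X = real N / s"
  define \<beta> where "\<beta> = x - real_of_int b / real q"
  define a where "a = (\<lambda>n. e (gauss_phase q b (Suc n)))"
  define w where "w = (\<lambda>n. e (real (Suc n) * \<beta>))"
  have s0: "0 < s" "s * s = real P" using q by (auto simp: s_def P_def)
  have N0: "real N > 0" using N by simp
  have PX: "8 * real P \<le> X"
  proof -
    \<comment> \<open>The bound \<open>262144 = 512^2\<close> on \<open>N\<close> covers
      \<open>q <= 512\<close>; for larger \<open>q\<close> the square \<open>q^2 <= N\<close> does.
      This gives \<open>512 * q^3 <= N^2\<close>, the square of
      \<open>8 * P * s <= N\<close>.\<close>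
    have "512 * q \<le> N"
    proof (cases "q \<le> 512")
      case False
      then have "512 * q \<le> q * q" by (intro mult_right_mono) auto
      also have "\<dots> \<le> N" using q(2) by (simp only: power2_eq_square)
      finally show ?thesis .
    qed (use N in auto)
    then have "512 * q ^ 3 \<le> N * q\<^sup>2"
      by (metis mult.assoc mult_le_mono1 power2_eq_square power3_eq_cube)
    also have "\<dots> \<le> N * N" using q(2) by simp
    finally have "512 * real q ^ 3 \<le> (real N)\<^sup>2"
      by (metis (mono_tags) of_nat_le_iff of_nat_mult of_nat_numeral of_nat_power power2_eq_square)
    moreover have "(8 * real P * s)\<^sup>2 = 512 * real q ^ 3"
      using s0(2) by (simp add: power_mult_distrib P_def power2_eq_square power3_eq_cube)
    ultimately have "8 * real P * s \<le> real N" by (metis power2_le_imp_le of_nat_0_le_iff)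
    then show ?thesis using s0 by (simp add: X_def field_simps)
  qed
  have X0: "0 \<le> X" using s0 by (simp add: X_def)
  have "weyl_sum N x (1 / (4 * real q)) = (\<Sum>n<N. a n * w n)"
    unfolding weyl_sum_def a_def w_def e_add[symmetric]
    by (simp add: sum.atLeast1_atMost_eq gauss_phase_def \<beta>_def algebra_simps)
  also have "\<dots> = (\<Sum>n<N. a n) * w N - (\<Sum>n<N. (\<Sum>k<Suc n. a k) * (w (Suc n) - w n))"
    by (rule summation_by_parts)
  finally have S: "cmod (\<Sum>n<N. a n) - cmod (\<Sum>n<N. (\<Sum>k<Suc n. a k) * (w (Suc n) - w n))
      \<le> cmod (weyl_sum N x (1 / (4 * real q)))"
    using norm_triangle_ineq2[of "(\<Sum>n<N. a n) * w N"] by (simp add: norm_mult w_def)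
  have "cmod (\<Sum>n<N. (\<Sum>k<Suc n. a k) * (w (Suc n) - w n)) \<le> (\<Sum>n<N. (X + real P) * (1 / (6 * real N)))"
  proof (rule sum_norm_le)
    fix n assume n: "n \<in> {..<N}"
    have "cmod (\<Sum>k<Suc n. a k) \<le> real (Suc n) / s + real P"
      unfolding a_def s_def P_def by (rule gauss_partial_sum(1)[OF q(1)])
    also have "real (Suc n) / s \<le> X"
      unfolding X_def using n s0 by (intro divide_right_mono) auto
    finally have 1: "cmod (\<Sum>k<Suc n. a k) \<le> X + real P" by simp
    have "cmod (w (Suc n) - w n) \<le> 2 * pi * \<bar>real (Suc (Suc n)) * \<beta> - real (Suc n) * \<beta>\<bar>"
      unfolding w_def by (rule norm_e_diff_le)
    also have "real (Suc (Suc n)) * \<beta> - real (Suc n) * \<beta> = \<beta>" by (simp add: algebra_simps)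
    also have "2 * pi * \<bar>\<beta>\<bar> \<le> 2 * (10/3) * (1 / (40 * real N))"
      using x pi_less_4 pi_approx by (intro mult_mono) (auto simp: \<beta>_def)
    also have "\<dots> = 1 / (6 * real N)" by simp
    finally show "cmod ((\<Sum>k<Suc n. a k) * (w (Suc n) - w n)) \<le> (X + real P) * (1 / (6 * real N))"
      unfolding norm_mult using 1 X0 by (intro mult_mono) auto
  qed
  also have "\<dots> = (X + real P) / 6" using N0 by simp
  finally have E: "cmod (\<Sum>n<N. (\<Sum>k<Suc n. a k) * (w (Suc n) - w n)) \<le> (X + real P) / 6" .
  have "X - 2 * real P \<le> cmod (\<Sum>n<N. a n)"
    unfolding X_def a_def s_def P_def by (rule gauss_partial_sum(2)[OF q(1)])
  then have "X - 2 * real P - (X + real P) / 6 \<le> cmod (weyl_sum N x (1 / (4 * real q)))"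
    using order_trans[OF diff_mono[OF _ E] S] by blast
  \<comment> \<open>With \<open>P <= X / 8\<close> the losses are at most
    \<open>1/4 + 1/6 + 1/48\<close> of \<open>X\<close>, less than one half.\<close>
  moreover have "X / 2 \<le> X - 2 * real P - (X + real P) / 6" using PX X0 by (simp add: field_simps)
  ultimately have "X / 2 \<le> cmod (weyl_sum N x (1 / (4 * real q)))" by (rule order_trans[rotated])
  also have "\<dots> \<le> maximal_sum N x"
    using q by (intro maximal_sum_upper) (auto simp: field_simps)
  finally show ?thesis by (simp add: X_def s_def P_def mult.commute)
qed

text \<open>Near \<open>x = 0\<close> the terms at \<open>t = 0\<close> are almost aligned. This
  single arc already has the right order for \<open>p > 4\<close>, and it makes the moment positive
  for every \<open>N\<close>.\<close>

lemma maximal_moment_ge_trivial: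
  assumes p: "p \<ge> 1" and N: "N > 0"
  shows "(real N / 2) powr p / (40 * real N) \<le> maximal_moment p N"
proof -
  have big: "real N / 2 \<le> maximal_sum N x" if x: "0 \<le> x" "x \<le> 1 / (40 * real N)" for x
  proof -
    have "cmod (weyl_sum N x 0 - weyl_sum N 0 0) \<le> 2 * pi * (real N)\<^sup>2 * \<bar>x - 0\<bar>"
      by (rule weyl_sum_lipschitz)
    also have "\<dots> \<le> 2 * 4 * (real N)\<^sup>2 * (1 / (40 * real N))"
      using x pi_less_4 by (intro mult_mono) auto
    also have "\<dots> \<le> real N / 2" using N by (simp add: power2_eq_square)
    finally have "cmod (weyl_sum N x 0 - of_nat N) \<le> real N / 2" by (simp add: weyl_sum_def)
    then have "real N / 2 \<le> cmod (weyl_sum N x 0)"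
      using norm_triangle_ineq2[of "of_nat N" "weyl_sum N x 0"] by (simp add: norm_minus_commute)
    also have "\<dots> \<le> maximal_sum N x" by (intro maximal_sum_upper) auto
    finally show ?thesis .
  qed
  have sub: "{0..1 / (40 * real N)} \<subseteq> {0..1}" using N by (auto simp: field_simps)
  have "(real N / 2) powr p / (40 * real N) = integral {0..1 / (40 * real N)} (\<lambda>x. (real N / 2) powr p)"
    using N by simp
  also have "\<dots> \<le> integral {0..1 / (40 * real N)} (\<lambda>x. maximal_sum N x powr p)"
    using p big by (intro integral_le integrable_maximal_sum_powr powr_mono2) auto
  also have "\<dots> \<le> integral {0..1} (\<lambda>x. maximal_sum N x powr p)"
    using p sub by (intro integral_subset_le integrable_maximal_sum_powr) auto
  finally show ?thesis by (simp add: maximal_moment_eq[OF p])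
qed

section \<open>Lower bounds for totient sums\<close>

text \<open>Write \<open>n\<close> as the sum of \<open>totient d\<close> over its divisors and
  exchange the summations. This reduces totient sums to elementary sums: \<open>g = 1\<close> serves
  for \<open>p < 4\<close>, \<open>g n = 1 / n^2\<close> for \<open>p = 4\<close>.\<close>

lemma sum_totient_swap:
  fixes g :: "nat \<Rightarrow> real"
  shows "(\<Sum>n=1..K. real n * g n) = (\<Sum>d=1..K. real (totient d) * (\<Sum>m=1..K div d. g (d * m)))"
proof -
  have "(\<Sum>n=1..K. real n * g n) = (\<Sum>n=1..K. \<Sum>d\<in>{d\<in>{1..K}. d dvd n}. real (totient d) * g n)"
  proof (rule sum.cong[OF refl])
    fix n assume n: "n \<in> {1..K}"
    then have "{d\<in>{1..K}. d dvd n} = {d. d dvd n}"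
      using dvd_imp_le[of _ n] by (fastforce intro: Nat.gr0I)
    moreover have "real n = (\<Sum>d | d dvd n. real (totient d))"
      using totient_divisor_sum[of n] by (metis of_nat_sum)
    ultimately show "real n * g n = (\<Sum>d\<in>{d\<in>{1..K}. d dvd n}. real (totient d) * g n)"
      by (simp add: sum_distrib_right)
  qed
  also have "\<dots> = (\<Sum>d=1..K. \<Sum>n\<in>{n\<in>{1..K}. d dvd n}. real (totient d) * g n)"
    by (rule sum.swap_restrict) auto
  also have "\<dots> = (\<Sum>d=1..K. real (totient d) * (\<Sum>m=1..K div d. g (d * m)))"
  proof (rule sum.cong[OF refl])
    fix d assume d: "d \<in> {1..K}"
    have "(\<Sum>n\<in>{n\<in>{1..K}. d dvd n}. g n) = (\<Sum>m=1..K div d. g (d * m))"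
      by (rule sum.reindex_bij_witness[where i = "\<lambda>m. d * m" and j = "\<lambda>n. n div d"])
        (use d in \<open>auto simp: div_le_mono Suc_le_eq div_greater_zero_iff less_eq_div_iff_mult_less_eq mult.commute dvd_imp_le\<close>)
    then show "(\<Sum>n\<in>{n\<in>{1..K}. d dvd n}. real (totient d) * g n) = real (totient d) * (\<Sum>m=1..K div d. g (d * m))"
      by (simp flip: sum_distrib_left)
  qed
  finally show ?thesis .
qed

text \<open>The subtracted \<open>1 / M\<close> lets the induction telescope. At
  \<open>M = 0\<close> it is 0 by convention, so the step to \<open>M = 1\<close> is
  separate.\<close>

lemma sum_inverse_squares_le: "(\<Sum>m=1..M. 1 / (real m)\<^sup>2) \<le> 2 - 1 / real M"
proof (induction M)
  case (Suc M)
  show ?case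
  proof (cases "M = 0")
    case False
    have "1 / (real (Suc M))\<^sup>2 \<le> 1 / (real M * real (Suc M))"
      using False unfolding power2_eq_square by (intro divide_left_mono mult_right_mono) auto
    also have "\<dots> = 1 / real M - 1 / real (Suc M)"
      using False by (simp add: field_simps)
    finally show ?thesis using Suc by simp
  qed simp
qed simp

text \<open>For \<open>g n = 1 / n^2\<close> the left side of the exchange is the harmonic sum,
  while the inner sums on the right are at most \<open>2 / d^2\<close>.\<close>

lemma sum_totient_div_square_ge: "ln (real K + 1) / 2 \<le> (\<Sum>q=1..K. real (totient q) / (real q)\<^sup>2)"
proof -
  have "ln (real K + 1) \<le> harm K" by (rule ln_le_harm)
  also have "harm K = (\<Sum>n=1..K. real n * (1 / (real n)\<^sup>2))"
    unfolding harm_def by (intro sum.cong refl) (auto simp: power2_eq_square field_simps)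
  also have "\<dots> = (\<Sum>d=1..K. real (totient d) * (\<Sum>m=1..K div d. 1 / (real (d * m))\<^sup>2))"
    by (rule sum_totient_swap)
  also have "\<dots> \<le> (\<Sum>d=1..K. real (totient d) * (2 / (real d)\<^sup>2))"
  proof (intro sum_mono mult_left_mono)
    fix d
    have "(\<Sum>m=1..K div d. 1 / (real (d * m))\<^sup>2) = (\<Sum>m=1..K div d. 1 / (real m)\<^sup>2) / (real d)\<^sup>2"
      by (simp add: sum_divide_distrib power_mult_distrib mult.commute)
    also have "\<dots> \<le> 2 / (real d)\<^sup>2"
    proof (rule divide_right_mono)
      have "(0::real) \<le> 1 / real (K div d)" by simp
      then show "(\<Sum>m=1..K div d. 1 / (real m)\<^sup>2) \<le> 2"
        using sum_inverse_squares_le[of "K div d"] by linarith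
    qed simp
    finally show "(\<Sum>m=1..K div d. 1 / (real (d * m))\<^sup>2) \<le> 2 / (real d)\<^sup>2" .
  qed auto
  also have "\<dots> = 2 * (\<Sum>q=1..K. real (totient q) / (real q)\<^sup>2)"
    by (simp add: sum_distrib_left mult_ac)
  finally show ?thesis by simp
qed

text \<open>For \<open>g = 1\<close> the exchange gives at least \<open>K^2 / 2\<close>. Each
  \<open>d\<close> up to \<open>K / 4\<close> accounts for at most \<open>K\<close>, together at
  most \<open>K^2 / 4\<close>; for larger \<open>d\<close> the quotient \<open>K div d\<close> is
  below 4. So four times the totient sum is at least \<open>K^2 / 4\<close>.\<close>

lemma sum_totient_ge: "(real K)\<^sup>2 / 16 \<le> (\<Sum>q=1..K. real (totient q))"
proof -
  have gauss: "(\<Sum>n=1..M. real n) = real M * (real M + 1) / 2" for M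
    by (induction M) (auto simp: field_simps)
  have "(real K)\<^sup>2 / 2 \<le> (\<Sum>n=1..K. real n * 1)"
    unfolding mult_1_right gauss by (simp add: power2_eq_square distrib_left)
  also have "\<dots> = (\<Sum>d=1..K. real (totient d) * real (K div d))"
    using sum_totient_swap[of "\<lambda>_. 1" K] by simp
  also have "\<dots> \<le> (\<Sum>d=1..K. (if d \<le> K div 4 then real K else 0) + 4 * real (totient d))"
  proof (rule sum_mono)
    fix d assume d: "d \<in> {1..K}"
    show "real (totient d) * real (K div d) \<le> (if d \<le> K div 4 then real K else 0) + 4 * real (totient d)"
    proof (cases "d \<le> K div 4")
      case True
      have "totient d * (K div d) \<le> d * (K div d)" by (intro mult_right_mono totient_le) auto
      also have "\<dots> \<le> K" by simp
      finally have "real (totient d) * real (K div d) \<le> real K" by (metis of_nat_le_iff of_nat_mult)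
      then show ?thesis using True by simp
    next
      case False
      then have "K < 4 * d" by linarith
      then have "K div d < 4" using d by (simp add: div_less_iff_less_mult)
      then have "real (totient d) * real (K div d) \<le> real (totient d) * 4"
        by (intro mult_left_mono) auto
      then show ?thesis using False by simp
    qed
  qed
  also have "\<dots> = (\<Sum>d=1..K. if d \<le> K div 4 then real K else 0) + 4 * (\<Sum>d=1..K. real (totient d))"
    by (simp add: sum.distrib sum_distrib_left)
  also have "(\<Sum>d=1..K. if d \<le> K div 4 then real K else 0) = real (K div 4) * real K"
  proof -
    have "{d\<in>{1..K}. d \<le> K div 4} = {1..K div 4}" by auto
    then show ?thesis by (simp add: sum.If_cases Int_def conj_commute)
  qed
  also have "\<dots> \<le> (real K / 4) * real K" 
  proof (rule mult_right_mono)
    have "real (4 * (K div 4)) \<le> real K" unfolding of_nat_le_iff by simp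
    then show "real (K div 4) \<le> real K / 4" by simp
  qed simp
  finally show ?thesis by (simp add: power2_eq_square field_simps)
qed

text \<open>Distinct fractions with denominators up to \<open>K\<close> differ by at least
  \<open>1 / (q * q') >= 1 / N\<close>, far more than \<open>1 / (40 * N)\<close>. So the cross
  difference is an integer smaller than 1 in modulus, and reduced fractions with equal values
  coincide.\<close>

lemma farey_arcs_disjoint:
  fixes K N q q' b b' :: nat
  assumes K: "K\<^sup>2 \<le> N" and q: "0 < q" "q \<le> K" "0 < q'" "q' \<le> K"
    and cop: "coprime b q" "coprime b' q'"
    and close: "\<bar>real b / real q - real b' / real q'\<bar> \<le> 1 / (40 * real N)"
  shows "q = q' \<and> b = b'"
proof -
  have N: "N > 0" using q(1,2) K by (auto intro: Nat.gr0I)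
  have "q * q' \<le> K * K" using q by (intro mult_mono) auto
  then have "q * q' \<le> N" using K by (simp add: power2_eq_square)
  then have qN: "real q * real q' \<le> real N" by (metis of_nat_le_iff of_nat_mult)
  have "real b * real q' - real b' * real q = (real b / real q - real b' / real q') * (real q * real q')"
    using q by (simp add: field_simps)
  then have "\<bar>real b * real q' - real b' * real q\<bar> \<le> (1 / (40 * real N)) * real N"
    using close qN by (simp only: abs_mult, intro mult_mono) auto
  then have "\<bar>real_of_int (int b * int q' - int b' * int q)\<bar> < 1" using N by simp
  then have "int b * int q' = int b' * int q" by linarith
  then have "b * q' = b' * q" by (metis of_nat_eq_iff of_nat_mult)
  then show ?thesis using coprime_crossproduct_nat[OF cop, of ] by auto
qed

lemma moment_ge_totient_sum:
  assumes p: "p \<ge> 1" and N: "N \<ge> 262144" and K: "K\<^sup>2 \<le> N"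
  shows "(real N / (2 * sqrt 2)) powr p / (40 * real N) * (\<Sum>q=1..K. real (totient q) * real q powr (- p / 2))
    \<le> maximal_moment p N"
proof -
  define \<delta> where "\<delta> = 1 / (40 * real N)"
  define B where "B = (SIGMA q:{1..K}. totatives q)"
  \<comment> \<open>One-sided arcs stay inside the unit interval even when \<open>b / q = 1\<close>,
    and two that meet have endpoints \<open>b / q\<close> at distance at most
    \<open>\<delta>\<close>, as the disjointness lemma requires.\<close>
  define I where "I = (\<lambda>(q, b). {real b / real q - \<delta> .. real b / real q})"
  define H where "H = (\<lambda>(q::nat, b::nat). (real N / (2 * sqrt (real (2 * q)))) powr p)"
  have finB: "finite B" by (simp add: B_def)
  have \<delta>: "0 < \<delta>" using N by (simp add: \<delta>_def)
  have B: "1 \<le> q" "q \<le> K" "0 < b" "b \<le> q" "coprime b q" if "(q, b) \<in> B" for q b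
    using that by (auto simp: B_def totatives_def)
  have sub: "I r \<subseteq> {0..1}" if "r \<in> B" for r
  proof -
    obtain q b where r: "r = (q, b)" by (cases r)
    note b = B[OF that[unfolded r]]
    have "q \<le> K\<^sup>2" using b by (simp add: power2_eq_square) (meson le_trans le_square)
    then have "real q \<le> 40 * real N" using K by simp
    then have "\<delta> \<le> 1 / real q" unfolding \<delta>_def using b by (intro divide_left_mono) auto
    also have "\<dots> \<le> real b / real q" using b by (intro divide_right_mono) auto
    finally have "\<delta> \<le> real b / real q" .
    moreover have "real b / real q \<le> 1" using b by simp
    ultimately show ?thesis by (auto simp: I_def r)
  qed
  have int_I: "integral {0..1} (indicat_real (I r)) = \<delta>" "indicat_real (I r) integrable_on {0..1}"
    if "r \<in> B" for r
  proof -
    have eq: "I r \<inter> {0..1} = I r" using sub[OF that] by auto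
    have meas: "I r \<in> lmeasurable" by (cases r) (simp add: I_def)
    show "integral {0..1} (indicat_real (I r)) = \<delta>"
    proof -
      have "measure lebesgue (I r) = \<delta>" using \<delta> by (cases r) (simp add: I_def)
      then show ?thesis using meas by (simp add: integral_indicator eq)
    qed
    show "indicat_real (I r) integrable_on {0..1}" using meas by (simp add: integrable_on_indicator eq)
  qed
  have major: "H r \<le> maximal_sum N x powr p" if r: "r \<in> B" "x \<in> I r" for r x
  proof -
    obtain q b where rqb: "r = (q, b)" by (cases r)
    note b = B[OF r(1)[unfolded rqb]]
    have "q\<^sup>2 \<le> N" using b K by (meson le_trans power2_nat_le_eq_le)
    then have "real N / (2 * sqrt (real (2 * q))) \<le> maximal_sum N x"
      using b r(2) \<delta> N by (intro maximal_sum_major_arc[where b = "int b"]) (auto simp: rqb I_def \<delta>_def[symmetric])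
    then show ?thesis using p unfolding H_def rqb by (auto intro!: powr_mono2)
  qed
  \<comment> \<open>The arcs are disjoint, so at most one summand is nonzero at \<open>x\<close>;
    there the major arc bound applies.\<close>
  have pointwise: "(\<Sum>r\<in>B. H r * indicat_real (I r) x) \<le> maximal_sum N x powr p" for x
  proof (cases "\<exists>r\<in>B. x \<in> I r")
    case True
    then obtain r where r: "r \<in> B" "x \<in> I r" by blast
    have uniq: "r' = r" if r': "r' \<in> B" "x \<in> I r'" for r'
    proof -
      obtain q b where rqb: "r = (q, b)" by (cases r)
      obtain q' b' where rqb': "r' = (q', b')" by (cases r')
      have "\<bar>real b / real q - real b' / real q'\<bar> \<le> 1 / (40 * real N)"
        using r(2) r'(2) unfolding rqb rqb' I_def \<delta>_def by auto
      moreover note b = B[OF r(1)[unfolded rqb]] and b' = B[OF r'(1)[unfolded rqb']]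
      moreover have "0 < q" "0 < q'" using b(1) b'(1) by auto
      ultimately have "q = q' \<and> b = b'" by (intro farey_arcs_disjoint[OF K])
      then show ?thesis by (simp add: rqb rqb')
    qed
    have "(\<Sum>r'\<in>B. H r' * indicat_real (I r') x) = (\<Sum>r'\<in>B. if r' = r then H r else 0)"
    proof (rule sum.cong[OF refl])
      fix r' assume "r' \<in> B"
      then have "x \<in> I r' \<longleftrightarrow> r' = r" using uniq[of r'] r(2) by blast
      then show "H r' * indicat_real (I r') x = (if r' = r then H r else 0)"
        using r(2) by (simp add: indicator_def)
    qed
    also have "\<dots> = H r" using finB r by simp
    finally show ?thesis using major[OF r] by simp
  next
    case False
    then have "(\<Sum>r\<in>B. H r * indicat_real (I r) x) = 0" by (intro sum.neutral) auto
    then show ?thesis by simp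
  qed
  have "(\<Sum>r\<in>B. H r * \<delta>) = (\<Sum>r\<in>B. integral {0..1} (\<lambda>x. H r * indicat_real (I r) x))"
    by (intro sum.cong refl) (simp add: int_I)
  also have "\<dots> = integral {0..1} (\<lambda>x. \<Sum>r\<in>B. H r * indicat_real (I r) x)"
    by (rule integral_sum[symmetric]) (auto intro: finB int_I integrable_on_mult_right)
  also have "\<dots> \<le> integral {0..1} (\<lambda>x. maximal_sum N x powr p)"
    by (intro integral_le integrable_maximal_sum_powr p pointwise integrable_sum finB integrable_on_mult_right int_I)
  also have "\<dots> = maximal_moment p N" by (rule maximal_moment_eq[OF p, symmetric])
  finally have "(\<Sum>r\<in>B. H r * \<delta>) \<le> maximal_moment p N" .
  moreover have "(\<Sum>r\<in>B. H r * \<delta>) = (\<Sum>q=1..K. \<Sum>b\<in>totatives q. H (q, b) * \<delta>)"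
    unfolding B_def by (subst sum.Sigma) auto
  moreover have "\<dots> = (\<Sum>q=1..K. (real N / (2 * sqrt 2)) powr p / (40 * real N) * (real (totient q) * real q powr (- p / 2)))"
  proof (rule sum.cong[OF refl])
    fix q assume q: "q \<in> {1..K}"
    define A where "A = real N / (2 * sqrt 2)"
    have eq1: "real N / (2 * sqrt (real (2 * q))) = A / sqrt (real q)"
      by (simp add: A_def real_sqrt_mult)
    have eq2: "(A / sqrt (real q)) powr p = A powr p / real q powr (p / 2)"
    proof -
      have "A \<ge> 0" by (simp add: A_def)
      then show ?thesis by (simp add: powr_divide powr_half_sqrt[symmetric] powr_powr)
    qed
    have "H (q, b) = (real N / (2 * sqrt 2)) powr p / real q powr (p / 2)" for b
      by (simp only: H_def prod.case eq1 eq2) (simp only: A_def)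
    then have "H (q, b) = (real N / (2 * sqrt 2)) powr p * real q powr (- p / 2)" for b
      by (simp add: powr_minus_divide)
    then show "(\<Sum>b\<in>totatives q. H (q, b) * \<delta>)
      = (real N / (2 * sqrt 2)) powr p / (40 * real N) * (real (totient q) * real q powr (- p / 2))"
      by (simp add: totient_def \<delta>_def)
  qed
  ultimately show ?thesis by (simp add: sum_distrib_left)
qed

section \<open>Moment bounds\<close>

text \<open>The scales form a geometric progression with ratio \<open>r = 2 powr (p - 4)\<close>,
  whose first term has order \<open>N powr (3 * p / 4)\<close>. The three cases are
  \<open>r < 1\<close>, \<open>r = 1\<close> and \<open>r > 1\<close>: a convergent series, a count
  of the scales, and domination by the last scale.\<close>

lemma moment_upper_bound:
  assumes p: "p \<ge> 1"
  obtains c where "c > 0" "\<And>N::nat. N \<ge> 2 \<Longrightarrow>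
    maximal_moment p N \<le> c * real N powr size_exponent p * ln (real N) powr log_exponent p"
proof -
  define K where "K = (414720000 * 2 powr p :: real)"
  define r where "r = (2::real) powr (p - 4)"
  have K0: "K > 0" and r0: "r > 0" by (simp_all add: K_def r_def)
  define D where "D = (24::real) powr p"
  define D' where "D' = (24::real) powr (p - 4)"
  have D0: "D > 0" "D' > 0" by (simp_all add: D_def D'_def)
  have "((2::real) ^ j) powr (p - 4) = r ^ j" for j
    unfolding r_def by (induction j) (simp_all add: powr_mult)
  then have level_powr: "(24 * Y * 2 ^ j) powr (p - 4) = D' * Y powr (p - 4) * r ^ j" if "Y \<ge> 0" for Y j
    using that by (simp add: powr_mult D'_def)
  have levels: "\<exists>J. (\<forall>j<J. 24 * real N powr (3/4) * 2 ^ j \<le> real N) \<and>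
      maximal_moment p N \<le> D * real N powr (3 * p / 4) + K * (D' * real N powr (3 * p / 4) * (\<Sum>j<J. r ^ j))"
    if N: "N > 0" for N :: nat
  proof -
    define l where "l = (\<lambda>j::nat. 24 * real N powr (3/4) * 2 ^ j)"
    obtain J where J: "\<And>j. j < J \<Longrightarrow> l j \<le> real N"
      "maximal_moment p N \<le> l 0 powr p + 414720000 * 2 powr p * (real N ^ 3 * (\<Sum>j<J. l j powr (p - 4)))"
      using moment_le_levels[OF p N l_def] by metis
    have l0: "l 0 powr p = D * real N powr (3 * p / 4)"
      using N by (simp add: l_def D_def powr_mult powr_powr)
    have lj: "real N ^ 3 * l j powr (p - 4) = D' * real N powr (3 * p / 4) * r ^ j" for j
    proof -
      have "l j powr (p - 4) = D' * real N powr (3/4 * (p - 4)) * r ^ j"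
        unfolding l_def by (subst level_powr) (simp_all add: powr_powr)
      moreover have "real N ^ 3 * real N powr (3/4 * (p - 4)) = real N powr (3 * p / 4)"
      proof -
        have "real N ^ 3 = real N powr 3" using N by (simp add: powr_numeral)
        then have "real N ^ 3 * real N powr (3/4 * (p - 4)) = real N powr (3 + 3/4 * (p - 4))"
          by (simp only: powr_add)
        also have "3 + 3/4 * (p - 4) = 3 * p / 4" by (simp add: field_simps)
        finally show ?thesis .
      qed
      ultimately show ?thesis by (simp add: mult_ac)
    qed
    have "real N ^ 3 * (\<Sum>j<J. l j powr (p - 4)) = D' * real N powr (3 * p / 4) * (\<Sum>j<J. r ^ j)"
      unfolding sum_distrib_left lj ..
    then have "maximal_moment p N \<le> D * real N powr (3 * p / 4) + K * (D' * real N powr (3 * p / 4) * (\<Sum>j<J. r ^ j))"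
      using J(2) by (simp only: l0 K_def)
    moreover have "\<forall>j<J. 24 * real N powr (3/4) * 2 ^ j \<le> real N"
      using J(1) by (simp add: l_def)
    ultimately show ?thesis by blast
  qed
  consider "p < 4" | "p = 4" | "p > 4" by linarith
  then show thesis
  proof cases
    case 1
    have r1: "r < 1" using 1 by (simp add: r_def powr_less_one)
    show thesis
    proof
      show "D + K * (D' / (1 - r)) > 0" using D0 K0 r1 by (simp add: add_pos_pos)
      fix N :: nat assume N: "N \<ge> 2"
      obtain J where J: "maximal_moment p N \<le> D * real N powr (3 * p / 4) + K * (D' * real N powr (3 * p / 4) * (\<Sum>j<J. r ^ j))"
        using levels[of N] N by auto
      have "(\<Sum>j<J. r ^ j) \<le> 1 / (1 - r)"
        using r0 r1 by (simp add: sum_gp_strict divide_right_mono)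
      then have "K * (D' * real N powr (3 * p / 4) * (\<Sum>j<J. r ^ j)) \<le> K * (D' * real N powr (3 * p / 4) * (1 / (1 - r)))"
        using K0 D0 by (intro mult_left_mono) auto
      then have "maximal_moment p N \<le> (D + K * (D' / (1 - r))) * real N powr (3 * p / 4)"
        using J by (simp add: algebra_simps)
      then show "maximal_moment p N \<le> (D + K * (D' / (1 - r))) * real N powr size_exponent p * ln (real N) powr log_exponent p"
        using 1 N by (simp add: size_exponent_def log_exponent_def)
    qed
  next
    case 2
    have r1: "r = 1" using 2 by (simp add: r_def)
    show thesis
    proof
      show "(D + K * D') / ln 2 > 0" using D0 K0 by (simp add: add_pos_pos)
      fix N :: nat assume N: "N \<ge> 2"
      obtain J where J: "\<And>j. j < J \<Longrightarrow> 24 * real N powr (3/4) * 2 ^ j \<le> real N" 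
        "maximal_moment p N \<le> D * real N powr (3 * p / 4) + K * (D' * real N powr (3 * p / 4) * (\<Sum>j<J. r ^ j))"
        using levels[of N] N by auto
      have lnN: "ln 2 \<le> ln (real N)" using N by simp
      \<comment> \<open>The last scale \<open>J - 1\<close> is still at most \<open>N\<close>, and
        its prefactor \<open>24 * N powr (3/4)\<close> is at least 2.\<close>
      have "2 ^ J \<le> real N"
      proof (cases J)
        case (Suc j)
        have "1 \<le> real N powr (3/4)" using N by (simp add: ge_one_powr_ge_zero)
        then have "2 * (2 ^ j) \<le> (24 * real N powr (3/4)) * 2 ^ j" by (intro mult_right_mono) auto
        also have "\<dots> \<le> real N" using J(1)[of j] Suc by simp
        finally show ?thesis using Suc by simp
      qed (use N in simp)
      then have "ln (2 ^ J) \<le> ln (real N)" using N by (subst ln_le_cancel_iff) auto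
      then have "real J * ln 2 \<le> ln (real N)" by (simp add: ln_realpow)
      then have J': "real J \<le> ln (real N) / ln 2" by (simp add: field_simps)
      have "maximal_moment p N \<le> D * real N powr 3 * 1 + K * (D' * real N powr 3 * real J)"
        using J(2) 2 r1 by simp
      \<comment> \<open>Since \<open>N >= 2\<close>, the quotient \<open>ln N / ln 2\<close> is at
        least 1, so the term without a logarithm is absorbed too.\<close>
      also have "\<dots> \<le> D * real N powr 3 * (ln (real N) / ln 2) + K * (D' * real N powr 3 * (ln (real N) / ln 2))"
        using J' lnN D0 K0 by (intro add_mono mult_left_mono) auto
      also have "\<dots> = (D + K * D') / ln 2 * real N powr 3 * ln (real N)"
        by (simp add: field_simps)
      finally show "maximal_moment p N \<le> (D + K * D') / ln 2 * real N powr size_exponent p * ln (real N) powr log_exponent p"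
        using 2 N by (simp add: size_exponent_def log_exponent_def)
    qed
  next
    case 3
    have r1: "r > 1" using 3 by (simp add: r_def)
    \<comment> \<open>Up to \<open>1 / (r - 1)\<close>, the geometric sum is the power of the first
      level beyond the range, which is at most twice the last level and so at most
      \<open>2 * N\<close>.\<close>
    define C where "C = 2 powr (p - 4) / (r - 1)"
    have C0: "C > 0" using r1 by (simp add: C_def)
    show thesis
    proof
      show "D + K * C > 0" using D0 K0 C0 by (simp add: add_pos_pos)
      fix N :: nat assume N: "N \<ge> 2"
      obtain J where J: "\<And>j. j < J \<Longrightarrow> 24 * real N powr (3/4) * 2 ^ j \<le> real N" 
        "maximal_moment p N \<le> D * real N powr (3 * p / 4) + K * (D' * real N powr (3 * p / 4) * (\<Sum>j<J. r ^ j))"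
        using levels[of N] N by auto
      have split: "real N powr (3 * p / 4) = real N powr 3 * (real N powr (3/4)) powr (p - 4)"
      proof -
        have "3 * p / 4 = 3 + 3/4 * (p - 4)" by (simp add: field_simps)
        then show ?thesis by (simp only: powr_add powr_powr)
      qed
      have geo: "D' * (real N powr (3/4)) powr (p - 4) * (\<Sum>j<J. r ^ j) \<le> C * real N powr (p - 4)"
      proof (cases J)
        case 0
        then show ?thesis using C0 by simp
      next
        case (Suc j)
        have "(\<Sum>j<J. r ^ j) = (r ^ J - 1) / (r - 1)" using r1 by (simp add: geometric_sum)
        also have "\<dots> \<le> r ^ J / (r - 1)" using r1 by (intro divide_right_mono) auto
        finally have "D' * (real N powr (3/4)) powr (p - 4) * (\<Sum>j<J. r ^ j)
            \<le> D' * (real N powr (3/4)) powr (p - 4) * (r ^ J / (r - 1))"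
          using D0 by (intro mult_left_mono) auto
        also have "\<dots> = (24 * real N powr (3/4) * 2 ^ J) powr (p - 4) / (r - 1)"
          by (subst level_powr) simp_all
        also have "\<dots> \<le> (2 * real N) powr (p - 4) / (r - 1)"
          using J(1)[of j] Suc 3 r1 by (intro divide_right_mono powr_mono2) (auto simp: mult_ac)
        also have "\<dots> = C * real N powr (p - 4)" using N by (simp add: C_def powr_mult)
        finally show ?thesis .
      qed
      have "K * (D' * real N powr (3 * p / 4) * (\<Sum>j<J. r ^ j))
        = K * real N powr 3 * (D' * (real N powr (3/4)) powr (p - 4) * (\<Sum>j<J. r ^ j))"
        unfolding split by (simp only: mult_ac)
      also have "\<dots> \<le> K * real N powr 3 * (C * real N powr (p - 4))"
        using geo K0 by (intro mult_left_mono) auto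
      also have "\<dots> = K * C * real N powr (p - 1)"
      proof -
        have "real N powr 3 * real N powr (p - 4) = real N powr (p - 1)"
          by (simp only: powr_add[symmetric]) (simp add: algebra_simps)
        then show ?thesis by (metis mult.assoc mult.left_commute)
      qed
      finally have 1: "K * (D' * real N powr (3 * p / 4) * (\<Sum>j<J. r ^ j)) \<le> K * C * real N powr (p - 1)" .
      \<comment> \<open>The inequality \<open>3 * p / 4 <= p - 1\<close> is equivalent to
        \<open>p >= 4\<close>.\<close>
      have "D * real N powr (3 * p / 4) \<le> D * real N powr (p - 1)"
        using N D0 3 by (intro mult_left_mono powr_mono) auto
      then have "maximal_moment p N \<le> (D + K * C) * real N powr (p - 1)"
        using J(2) 1 by (simp add: distrib_right)
      then show "maximal_moment p N \<le> (D + K * C) * real N powr size_exponent p * ln (real N) powr log_exponent p"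
        using 3 N by (simp add: size_exponent_def log_exponent_def)
    qed
  qed
qed

text \<open>With \<open>K\<close> the integer part of \<open>sqrt N\<close>: for
  \<open>p < 4\<close> the weights are at least \<open>K powr (- p / 2)\<close> and the totients sum
  to order \<open>K^2\<close>, so the arcs give \<open>N powr (p - 1 + 1 - p / 4)\<close>; for
  \<open>p = 4\<close> the weighted sum is logarithmic; for \<open>p > 4\<close> the arc at
  \<open>0\<close> suffices.\<close>

lemma moment_lower_bound_large:
  assumes p: "p \<ge> 1"
  obtains c where "c > 0" "\<And>N::nat. N \<ge> 262144 \<Longrightarrow>
    c * real N powr size_exponent p * ln (real N) powr log_exponent p \<le> maximal_moment p N"
proof -
  define E where "E = (1 / (2 * sqrt 2)) powr p / 40"
  have E0: "E > 0" by (simp add: E_def)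
  have arcs: "\<exists>K::nat. sqrt (real N) / 2 \<le> real K \<and> sqrt (real N) \<le> real K + 1 \<and> 
      E * real N powr (p - 1) * (\<Sum>q=1..K. real (totient q) * real q powr (- p / 2)) \<le> maximal_moment p N"
    if N: "N \<ge> 262144" for N :: nat
  proof -
    define K where "K = nat \<lfloor>sqrt (real N)\<rfloor>"
    have "real K \<le> sqrt (real N)" by (simp add: K_def)
    then have "(real K)\<^sup>2 \<le> real N" by (metis of_nat_0_le_iff power_mono real_sqrt_pow2)
    then have K: "K\<^sup>2 \<le> N" by (metis of_nat_le_iff of_nat_power)
    have K1: "sqrt (real N) \<le> real K + 1" unfolding K_def by linarith
    have "2 \<le> sqrt (real N)" using N by (intro real_le_rsqrt) auto
    then have K2: "sqrt (real N) / 2 \<le> real K" using K1 by linarith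
    have "(real N / (2 * sqrt 2)) powr p / (40 * real N) = E * real N powr (p - 1)"
      using N by (simp add: E_def powr_divide powr_diff)
    then show ?thesis using moment_ge_totient_sum[OF p N K] K1 K2 by (intro exI[of _ K]) auto
  qed
  consider "p < 4" | "p = 4" | "p > 4" by linarith
  then show thesis
  proof cases
    case 1
    define c where "c = E * ((1/2) powr (2 - p / 2) / 16)"
    show thesis
    proof
      show "c > 0" using E0 by (simp add: c_def)
      fix N :: nat assume N: "N \<ge> 262144"
      obtain K :: nat where K: "sqrt (real N) / 2 \<le> real K"
        "E * real N powr (p - 1) * (\<Sum>q=1..K. real (totient q) * real q powr (- p / 2)) \<le> maximal_moment p N"
        using arcs[OF N] by auto
      have K0: "0 < real K" using K(1) N by (smt (verit) half_gt_zero of_nat_0_less_iff real_sqrt_gt_zero zero_less_numeral less_le_trans)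
      have "(1/2) powr (2 - p / 2) * real N powr (1 - p / 4) = (sqrt (real N) / 2) powr (2 - p / 2)"
        using N by (simp add: powr_half_sqrt[symmetric] powr_divide powr_powr algebra_simps)
      \<comment> \<open>The exponent \<open>2 - p / 2\<close> is positive exactly because
        \<open>p < 4\<close>.\<close>
      also have "\<dots> \<le> real K powr (2 - p / 2)"
        using 1 K(1) by (intro powr_mono2) auto
      also have "\<dots> = real K powr (- p / 2) * (real K)\<^sup>2"
        using K0 by (simp add: powr_diff powr_minus_divide powr_numeral)
      finally have "(1/2) powr (2 - p / 2) / 16 * real N powr (1 - p / 4) \<le> real K powr (- p / 2) * ((real K)\<^sup>2 / 16)"
        by simp
      also have "\<dots> \<le> real K powr (- p / 2) * (\<Sum>q=1..K. real (totient q))"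
        by (intro mult_left_mono sum_totient_ge) auto
      also have "\<dots> \<le> (\<Sum>q=1..K. real (totient q) * real q powr (- p / 2))"
        unfolding sum_distrib_left
      proof (rule sum_mono)
        fix q assume "q \<in> {1..K}"
        then have "real K powr (- p / 2) \<le> real q powr (- p / 2)"
          using p by (intro powr_mono2') auto
        then show "real K powr (- p / 2) * real (totient q) \<le> real (totient q) * real q powr (- p / 2)"
          by (simp add: mult.commute mult_left_mono)
      qed
      finally have "E * real N powr (p - 1) * ((1/2) powr (2 - p / 2) / 16 * real N powr (1 - p / 4)) \<le> maximal_moment p N"
        using E0 K(2) by (meson mult_left_mono order_trans mult_nonneg_nonneg powr_ge_zero less_imp_le)
      moreover have "real N powr (p - 1) * real N powr (1 - p / 4) = real N powr (3 * p / 4)"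
        by (simp add: powr_add[symmetric])
      ultimately have "c * real N powr (3 * p / 4) \<le> maximal_moment p N"
        unfolding c_def by (metis mult.assoc mult.left_commute)
      then show "c * real N powr size_exponent p * ln (real N) powr log_exponent p \<le> maximal_moment p N"
        using 1 N by (simp add: size_exponent_def log_exponent_def)
    qed
  next
    case 2
    show thesis
    proof
      show "E / 4 > 0" using E0 by simp
      fix N :: nat assume N: "N \<ge> 262144"
      obtain K :: nat where K: "sqrt (real N) \<le> real K + 1"
        "E * real N powr (p - 1) * (\<Sum>q=1..K. real (totient q) * real q powr (- p / 2)) \<le> maximal_moment p N"
        using arcs[OF N] by auto
      have "ln (real N) / 4 = ln (sqrt (real N)) / 2" using N by (simp add: ln_sqrt)
      also have "\<dots> \<le> ln (real K + 1) / 2" using N K(1) by (intro divide_right_mono ln_mono) auto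
      also have "\<dots> \<le> (\<Sum>q=1..K. real (totient q) / (real q)\<^sup>2)" by (rule sum_totient_div_square_ge)
      also have "\<dots> = (\<Sum>q=1..K. real (totient q) * real q powr (- p / 2))"
        using 2 by (intro sum.cong refl) (auto simp: powr_minus_divide powr_numeral)
      finally have "E * real N powr (p - 1) * (ln (real N) / 4) \<le> maximal_moment p N"
        using E0 K(2) by (meson mult_left_mono order_trans mult_nonneg_nonneg powr_ge_zero less_imp_le)
      then show "E / 4 * real N powr size_exponent p * ln (real N) powr log_exponent p \<le> maximal_moment p N"
        using 2 N by (simp add: size_exponent_def log_exponent_def)
    qed
  next
    case 3
    show thesis
    proof
      show "(1/2) powr p / 40 > (0::real)" by simp
      fix N :: nat assume N: "N \<ge> 262144"
      have "(real N / 2) powr p / (40 * real N) = (1/2) powr p / 40 * real N powr (p - 1)"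
        using N by (simp add: powr_divide powr_diff)
      then show "(1/2) powr p / 40 * real N powr size_exponent p * ln (real N) powr log_exponent p \<le> maximal_moment p N"
        using 3 N maximal_moment_ge_trivial[OF p, of N] by (simp add: size_exponent_def log_exponent_def)
    qed
  qed
qed

text \<open>Only finitely many \<open>N\<close> lie below the range of the previous lemma. For each
  of them the moment and the comparison function are positive, so the constant is the minimum of
  \<open>c\<close> and finitely many positive ratios.\<close>

lemma moment_lower_bound:
  assumes p: "p \<ge> 1"
  obtains c where "c > 0" "\<And>N::nat. N \<ge> 2 \<Longrightarrow>
    c * real N powr size_exponent p * ln (real N) powr log_exponent p \<le> maximal_moment p N"
proof -
  obtain c where c: "c > 0" "\<And>N::nat. N \<ge> 262144 \<Longrightarrow>
    c * real N powr size_exponent p * ln (real N) powr log_exponent p \<le> maximal_moment p N"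
    using moment_lower_bound_large[OF p] by blast
  define h where "h = (\<lambda>N::nat. real N powr size_exponent p * ln (real N) powr log_exponent p)"
  have h0: "h N > 0" if "N \<ge> 2" for N using that by (simp add: h_def)
  have m0: "maximal_moment p N > 0" if "N \<ge> 2" for N
  proof -
    have "0 < (real N / 2) powr p / (40 * real N)" using that by simp
    also have "\<dots> \<le> maximal_moment p N" using that by (intro maximal_moment_ge_trivial p) simp
    finally show ?thesis .
  qed
  define S where "S = insert c ((\<lambda>N. maximal_moment p N / h N) ` {2..<262144})"
  have fin: "finite S" "S \<noteq> {}" by (simp_all add: S_def)
  have pos: "\<forall>s\<in>S. s > 0" using c(1) h0 m0 by (auto simp: S_def)
  show thesis
  proof
    show "Min S > 0" using fin pos by simp
    fix N :: nat assume N: "N \<ge> 2"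
    have "Min S * h N \<le> maximal_moment p N"
    proof (cases "N \<ge> 262144")
      case True
      have "Min S \<le> c" using fin by (intro Min_le) (auto simp: S_def)
      then have "Min S * h N \<le> c * h N" using h0[OF N] by (intro mult_right_mono) auto
      then show ?thesis using c(2)[OF True] by (simp add: h_def mult.assoc)
    next
      case False
      have "Min S \<le> maximal_moment p N / h N" using fin False N by (intro Min_le) (auto simp: S_def)
      then show ?thesis using h0[OF N] by (simp add: field_simps)
    qed
    then show "Min S * real N powr size_exponent p * ln (real N) powr log_exponent p \<le> maximal_moment p N"
      by (simp add: h_def mult.assoc)
  qed
qed

theorem mainTheorem1:
  fixes p :: real
  assumes "p \<ge> 1"
  shows "\<exists>c\<^sub>1 c\<^sub>2 :: real. c\<^sub>1 > 0 \<and> c\<^sub>2 > 0 \<and>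
    (\<forall>N::nat. N \<ge> 2 \<longrightarrow>
      c\<^sub>1 * real N powr size_exponent p * ln (real N) powr log_exponent p \<le> maximal_moment p N \<and>
      maximal_moment p N \<le> c\<^sub>2 * real N powr size_exponent p * ln (real N) powr log_exponent p)"
  by (rule moment_lower_bound[OF assms], rule moment_upper_bound[OF assms]) blast

end
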